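(* Let $A$ be a commutative ring, $I$ a set, $G$ a commutative group, $\psi\colon\mathbb{Z}^{\oplus I}\twoheadrightarrow G$ an epimorphism of groups, and let $R=A[(X_i)_{i\in I}]$ be the polynomial algebra, furnished with the $G$-graduation derived from its canonical $\mathbb{Z}^{\oplus I}$-graduation by means of $\psi$. The following statements are equivalent: (i) the nilradical $\operatorname{Nil}(A)$ of $A$ is nilpotent; (ii) for every monomial ideal $\mathfrak{a}\subseteq R$ we have $\Gamma_{\lfloor\mathfrak{a}\rfloor}=\Gamma_{\sqrt{\mathfrak{a}}}$; (iii) there exists a monomial ideal $\mathfrak{a}\subseteq R$ with $\Gamma_{\lfloor\mathfrak{a}\rfloor}=\Gamma_{\sqrt{\mathfrak{a}}}$.
   Context: Rings are commutative with unit and $\mathbb{N}$ contains $0$. A monomial in $R$ is an element of the form $\prod_{i\in I}X_i^{\mu_i}$ with $\mu=(\mu_i)_{i\in I}\in\mathbb{N}^{\oplus I}$; it is homogeneous of degree $\psi(\mu)\in G$. A monomial ideal of $R$ is an ideal generated by a set of monomials in $R$; monomial ideals are graded, and so are their radicals. For a monomial ideal $\mathfrak{a}\subseteq R$ there is a unique subset $E(\mathfrak{a})\subseteq\mathbb{N}^{\oplus I}$ such that $\{\prod_{i\in I}X_i^{\mu_i}\mid\mu\in E(\mathfrak{a})\}$ is a minimal generating set of $\mathfrak{a}$, and one defines the monomial ideal $\lfloor\mathfrak{a}\rfloor:=\langle\prod_{i\in I,\,\mu_i>0}X_i\mid\mu\in E(\mathfrak{a})\rangle_R$. $\sqrt{\mathfrak{a}}$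 denotes the radical of $\mathfrak{a}$. For a graded ideal $\mathfrak{c}\subseteq R$, $\Gamma_{\mathfrak{c}}$ denotes the $G$-graded $\mathfrak{c}$-torsion functor, i.e. the subfunctor of the identity functor on the category of $G$-graded $R$-modules with $\Gamma_{\mathfrak{c}}(M)=\bigcup_{n\in\mathbb{N}}(0:_M\mathfrak{c}^n)$ for every $G$-graded $R$-module $M$. Equality of such functors is equality as subfunctors of the identity functor.
   Formalization: In (iii) the monomial ideal 𝔞 is required to be proper (𝔞 ≠ R) unless A is the zero ring; with 𝔞 = R allowed, (iii) always holds, since ⌊R⌋ = √R = R, and (iii) ⇒ (i) fails when Nil(A) is not nilpotent. *)

theory Defs
  imports "HOL-Algebra.Algebra" "HOL-Algebra.Free_Abelian_Groups"
begin

section \<open>The polynomial algebra and its graduation\<close>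

text \<open>A polynomial is the finitely supported family of its coefficients, indexed by the
  exponents. Both the index set \<open>I\<close> and the ring \<open>A\<close> are given by carriers, so that \<open>I\<close> may be
  empty or infinite and \<open>A\<close> may be the zero ring. Exponents are the \<open>\<mu>\<close> with
  \<open>Poly_Mapping.keys \<mu> \<subseteq> I\<close>.\<close>

type_synonym ('i, 'a) mpoly = "('i \<Rightarrow>\<^sub>0 nat) \<Rightarrow> 'a"

definition exponents :: "'i set \<Rightarrow> ('i \<Rightarrow>\<^sub>0 nat) set" where
  "exponents I = {\<mu>. Poly_Mapping.keys \<mu> \<subseteq> I}"

definition poly_alg :: "('a, 'k) ring_scheme \<Rightarrow> 'i set \<Rightarrow> ('i, 'a) mpoly ring" where
  "poly_alg A I =
    \<lparr> carrier = {f. (\<forall>\<mu>. f \<mu> \<in> carrier A) \<and> finite {\<mu>. f \<mu> \<noteq> \<zero>\<^bsub>A\<^esub>} \<and>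
                    {\<mu>. f \<mu> \<noteq> \<zero>\<^bsub>A\<^esub>} \<subseteq> exponents I},
      monoid.mult = (\<lambda>f g \<mu>. finsum A (\<lambda>(\<alpha>, \<beta>). f \<alpha> \<otimes>\<^bsub>A\<^esub> g \<beta>) {(\<alpha>, \<beta>). \<alpha> + \<beta> = \<mu>}),
      monoid.one = (\<lambda>\<mu>. if \<mu> = 0 then \<one>\<^bsub>A\<^esub> else \<zero>\<^bsub>A\<^esub>),
      ring.zero = (\<lambda>\<mu>. \<zero>\<^bsub>A\<^esub>),
      ring.add = (\<lambda>f g \<mu>. f \<mu> \<oplus>\<^bsub>A\<^esub> g \<mu>) \<rparr>"

definition var :: "('a, 'k) ring_scheme \<Rightarrow> 'i \<Rightarrow> ('i, 'a) mpoly" where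
  "var A i = (\<lambda>\<mu>. if \<mu> = Poly_Mapping.single i 1 then \<one>\<^bsub>A\<^esub> else \<zero>\<^bsub>A\<^esub>)"

text \<open>The component of degree \<open>g\<close> of the \<open>G\<close>-graduation obtained from the canonical graduation
  by means of \<open>\<psi>\<close>; the exponents are embedded into the free abelian group on \<open>I\<close> by
  \<open>Poly_Mapping.map int\<close>.\<close>

definition poly_component ::
  "('a, 'k) ring_scheme \<Rightarrow> 'i set \<Rightarrow> (('i \<Rightarrow>\<^sub>0 int) \<Rightarrow> 'g) \<Rightarrow> 'g \<Rightarrow> ('i, 'a) mpoly set" where
  "poly_component A I \<psi> g =
    {f \<in> carrier (poly_alg A I). \<forall>\<mu>. f \<mu> \<noteq> \<zero>\<^bsub>A\<^esub> \<longrightarrow> \<psi> (Poly_Mapping.map int \<mu>) = g}"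


section \<open>Monomial ideals\<close>

definition monomial :: "('a, 'k) ring_scheme \<Rightarrow> 'i set \<Rightarrow> ('i \<Rightarrow>\<^sub>0 nat) \<Rightarrow> ('i, 'a) mpoly" where
  "monomial A I \<mu> =
    finprod (poly_alg A I)
      (\<lambda>i. var A i [^]\<^bsub>poly_alg A I\<^esub> Poly_Mapping.lookup \<mu> i) (Poly_Mapping.keys \<mu>)"

definition monomial_ideal :: "('a, 'k) ring_scheme \<Rightarrow> 'i set \<Rightarrow> ('i, 'a) mpoly set \<Rightarrow> bool" where
  "monomial_ideal A I \<aa> \<longleftrightarrow>
    (\<exists>S \<subseteq> exponents I. \<aa> = genideal (poly_alg A I) (monomial A I ` S))"

definition minimal_generating_set :: "('r, 'k) ring_scheme \<Rightarrow> 'r set \<Rightarrow> 'r set \<Rightarrow> bool" where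
  "minimal_generating_set R \<aa> S \<longleftrightarrow>
    S \<subseteq> carrier R \<and> genideal R S = \<aa> \<and> (\<forall>T. T \<subset> S \<longrightarrow> genideal R T \<noteq> \<aa>)"

definition min_exponents :: "('a, 'k) ring_scheme \<Rightarrow> 'i set \<Rightarrow> ('i, 'a) mpoly set \<Rightarrow> ('i \<Rightarrow>\<^sub>0 nat) set"
  where "min_exponents A I \<aa> =
    (THE E. E \<subseteq> exponents I \<and>
            minimal_generating_set (poly_alg A I) \<aa> (monomial A I ` E))"

definition squarefree_part_ideal ::
  "('a, 'k) ring_scheme \<Rightarrow> 'i set \<Rightarrow> ('i, 'a) mpoly set \<Rightarrow> ('i, 'a) mpoly set" where
  "squarefree_part_ideal A I \<aa> =
    genideal (poly_alg A I)
      ((\<lambda>\<mu>. finprod (poly_alg A I) (var A) {i \<in> I. Poly_Mapping.lookup \<mu> i > 0})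
        ` min_exponents A I \<aa>)"


section \<open>Radicals and nilpotency of ideals\<close>

definition ideal_radical :: "('r, 'k) ring_scheme \<Rightarrow> 'r set \<Rightarrow> 'r set" where
  "ideal_radical R \<aa> = {x \<in> carrier R. \<exists>n::nat. x [^]\<^bsub>R\<^esub> n \<in> \<aa>}"

definition nilradical :: "('r, 'k) ring_scheme \<Rightarrow> 'r set" where
  "nilradical R = ideal_radical R {\<zero>\<^bsub>R\<^esub>}"

text \<open>Powers of ideals are taken in the monoid \<open>ideals_set R\<close> of ideals of \<open>R\<close>; in particular
  the power with exponent \<open>0\<close> is \<open>R\<close> itself.\<close>

definition nilpotent_ideal :: "('r, 'k) ring_scheme \<Rightarrow> 'r set \<Rightarrow> bool" where
  "nilpotent_ideal R \<aa> \<longleftrightarrow> (\<exists>n::nat. \<aa> [^]\<^bsub>ideals_set R\<^esub> n = {\<zero>\<^bsub>R\<^esub>})"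


section \<open>Graded modules and torsion functors\<close>

text \<open>\<open>M\<close> is a graded module over the graded ring \<open>R\<close> with components \<open>Rg g\<close>: it is the direct sum
  of the subgroups \<open>Mg g\<close>. The group of degrees is written multiplicatively.\<close>

locale graded_module = module R M
  for R :: "('r, 'k) ring_scheme" (structure)
    and Rg :: "'g \<Rightarrow> 'r set"
    and G :: "('g, 'l) monoid_scheme"
    and M :: "('r, 'm) module"
    and Mg :: "'g \<Rightarrow> 'm set" +
  assumes component_subgroup: "g \<in> carrier G \<Longrightarrow> additive_subgroup (Mg g) M"
    and smult_component:
      "\<lbrakk>g \<in> carrier G; h \<in> carrier G; r \<in> Rg g; x \<in> Mg h\<rbrakk>
        \<Longrightarrow> r \<odot>\<^bsub>M\<^esub> x \<in> Mg (g \<otimes>\<^bsub>G\<^esub> h)"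
    and direct_sum:
      "x \<in> carrier M \<Longrightarrow>
        \<exists>!y. y \<in> (\<Pi>\<^sub>E g\<in>carrier G. Mg g) \<and>
             finite {g \<in> carrier G. y g \<noteq> \<zero>\<^bsub>M\<^esub>} \<and>
             x = finsum M y {g \<in> carrier G. y g \<noteq> \<zero>\<^bsub>M\<^esub>}"

definition annihilated_part ::
  "('r, 'm) module \<Rightarrow> 'r set \<Rightarrow> 'm set" where
  "annihilated_part M \<cc> = {x \<in> carrier M. \<forall>r\<in>\<cc>. r \<odot>\<^bsub>M\<^esub> x = \<zero>\<^bsub>M\<^esub>}"

definition torsion :: "('r, 'k) ring_scheme \<Rightarrow> 'r set \<Rightarrow> ('r, 'm) module \<Rightarrow> 'm set" where
  "torsion R \<cc> M = (\<Union>n::nat. annihilated_part M (\<cc> [^]\<^bsub>ideals_set R\<^esub> n))"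

text \<open>Equality of the torsion functors of two graded ideals as subfunctors of the identity, on the
  graded modules whose elements are taken from the type \<open>'m\<close>. The graduation of a graded
  submodule is induced from the ambient module, so subobjects are compared by their carriers.\<close>

definition torsion_functors_eq ::
  "'m itself \<Rightarrow> ('r, 'k) ring_scheme \<Rightarrow> ('g \<Rightarrow> 'r set) \<Rightarrow> ('g, 'l) monoid_scheme
    \<Rightarrow> 'r set \<Rightarrow> 'r set \<Rightarrow> bool" where
  "torsion_functors_eq _ R Rg G \<cc> \<dd> \<longleftrightarrow>
    (\<forall>(M :: ('r, 'm) module) Mg. graded_module R Rg G M Mg \<longrightarrow> torsion R \<cc> M = torsion R \<dd> M)"

text \<open>The case of the polynomial algebra. Elements of modules are taken from the disjoint sum of the
  type of polynomials and a further type \<open>'u\<close>. As \<open>'u\<close> is arbitrary, this covers an isomorphic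
  copy of every graded module on any type, while the first summand ensures that there is always
  room for the cyclic modules.\<close>

definition monomial_torsion_eq ::
  "'u itself \<Rightarrow> ('a, 'k) ring_scheme \<Rightarrow> 'i set \<Rightarrow> ('g, 'l) monoid_scheme
    \<Rightarrow> (('i \<Rightarrow>\<^sub>0 int) \<Rightarrow> 'g) \<Rightarrow> ('i, 'a) mpoly set \<Rightarrow> bool" where
  "monomial_torsion_eq _ A I G \<psi> \<aa> \<longleftrightarrow>
    torsion_functors_eq TYPE(('i, 'a) mpoly + 'u) (poly_alg A I) (poly_component A I \<psi>) G
      (squarefree_part_ideal A I \<aa>) (ideal_radical (poly_alg A I) \<aa>)"

text \<open>The unit ideal \<open>\<aa> = R\<close> is a monomial ideal (generated by the monomial with exponent \<open>0\<close>) for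
  which both torsion functors vanish identically, whatever \<open>A\<close> is. A statement asserting the
  existence of a monomial ideal with equal torsion functors is therefore only informative for
  proper ideals; over the zero ring there is no proper ideal and nothing needs to be excluded.\<close>

end

(* Let L be the squarefree part of the monomial ideal a and N the nilradical of A. A polynomial
   in the radical of a has nilpotent coefficients outside the support of L: maximize the Euclidean
   norm over the offending exponents and look at the square. Hence L <= rad a <= L + N R, and
   N^n = 0 gives (rad a)^(m + n) <= L^m, so both torsion functors agree. Conversely, if a is
   proper, then L acts by zero on the graded module A = R / (all variables), concentrated in
   degree 1_G. If 1 is torsion for rad a, then some power (rad a)^n annihilates it, and this
   power contains the constants from N^n. *)

theory Submission
  imports Defs
begin

section \<open>The polynomial algebra\<close>

text \<open>Isolating a bad coefficient by leading terms would need a monomial order on a possibly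
  infinite set of variables. Strict convexity of the Euclidean norm replaces it: an exponent of
  maximal norm is not the midpoint of two other exponents of at most that norm. Squares are enough,
  because membership of a power \<open>x^n\<close> in an ideal that is closed under square roots
  descends to \<open>x\<close> by repeatedly halving \<open>n\<close>. The ideals compared here
  (monomial ideals, \<open>N R\<close>, \<open>L + N R\<close>) are handled by a condition on each
  coefficient separately, so that containments can be checked exponent by exponent. The nilpotency
  exponent of N enters as a shift of the power that is the same for all powers of L. In the converse
  direction nothing but constant terms has to be observed, which is why a module on which every
  variable acts by zero suffices as a test object.\<close>

lemma finite_sum_pairs: "finite {(\<alpha>, \<beta>). \<alpha> + \<beta> = (\<mu> :: 'i \<Rightarrow>\<^sub>0 nat)}"
proof -
  let ?K = "Poly_Mapping.keys \<mu>"
  let ?N = "Max (Poly_Mapping.lookup \<mu> ` ?K)"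
  let ?D = "{\<alpha>. \<exists>\<beta>. \<alpha> + \<beta> = \<mu>}"
  \<comment> \<open>A summand of \<mu> vanishes off the keys of \<mu> and is bounded on them by the
    largest value of \<mu>, which leaves finitely many functions.\<close>
  have "Poly_Mapping.lookup ` ?D \<subseteq> {f. \<forall>i. (i \<in> ?K \<longrightarrow> f i \<in> {..?N}) \<and> (i \<notin> ?K \<longrightarrow> f i = 0)}"
  proof clarsimp
    fix \<alpha> \<beta> :: "'i \<Rightarrow>\<^sub>0 nat" and i assume *: "\<mu> = \<alpha> + \<beta>"
    show "(i \<in> Poly_Mapping.keys (\<alpha> + \<beta>) \<longrightarrow> Poly_Mapping.lookup \<alpha> i
        \<le> Max (Poly_Mapping.lookup (\<alpha> + \<beta>) ` Poly_Mapping.keys (\<alpha> + \<beta>))) \<and>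
      (i \<notin> Poly_Mapping.keys (\<alpha> + \<beta>) \<longrightarrow> Poly_Mapping.lookup \<alpha> i = 0)"
    proof (intro conjI impI)
      assume "i \<in> Poly_Mapping.keys (\<alpha> + \<beta>)"
      then have "Poly_Mapping.lookup (\<alpha> + \<beta>) i
          \<le> Max (Poly_Mapping.lookup (\<alpha> + \<beta>) ` Poly_Mapping.keys (\<alpha> + \<beta>))" by simp
      then show "Poly_Mapping.lookup \<alpha> i
          \<le> Max (Poly_Mapping.lookup (\<alpha> + \<beta>) ` Poly_Mapping.keys (\<alpha> + \<beta>))"
        by (simp only: Poly_Mapping.lookup_add)
    next
      assume "i \<notin> Poly_Mapping.keys (\<alpha> + \<beta>)"
      then show "Poly_Mapping.lookup \<alpha> i = 0"
        by (simp add: in_keys_iff Poly_Mapping.lookup_add)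
    qed
  qed
  then have "finite (Poly_Mapping.lookup ` ?D)"
    by (rule finite_subset) (intro finite_set_of_finite_funs, auto)
  then have "finite ?D"
    by (rule finite_imageD) (simp add: inj_on_def poly_mapping_eqI)
  moreover have "{(\<alpha>, \<beta>). \<alpha> + \<beta> = \<mu>} \<subseteq> (\<lambda>\<alpha>. (\<alpha>, \<mu> - \<alpha>)) ` ?D"
    by (auto simp: image_iff)
  ultimately show ?thesis by (meson finite_imageI finite_subset)
qed

lemma keys_add_nat: "Poly_Mapping.keys (\<alpha> + \<beta>) = Poly_Mapping.keys \<alpha> \<union> Poly_Mapping.keys (\<beta> :: 'i \<Rightarrow>\<^sub>0 nat)"
  by (auto simp: in_keys_iff Poly_Mapping.lookup_add)

lemma exponents_add_iff: "\<alpha> + \<beta> \<in> exponents I \<longleftrightarrow> \<alpha> \<in> exponents I \<and> \<beta> \<in> exponents I"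
  by (simp add: exponents_def keys_add_nat)

text \<open>Serves associativity of the polynomial product: a nested sum becomes a sum over one
  index set, which can then be reindexed.\<close>

lemma (in abelian_monoid) finsum_Sigma:
  assumes "finite S" "\<And>x. x \<in> S \<Longrightarrow> finite (B x)" "\<And>x y. x \<in> S \<Longrightarrow> y \<in> B x \<Longrightarrow> h x y \<in> carrier G"
  shows "(\<Oplus>x\<in>S. \<Oplus>y\<in>B x. h x y) = (\<Oplus>p\<in>Sigma S B. case p of (x, y) \<Rightarrow> h x y)"
  using assms
proof (induction S rule: finite_induct)
  case empty
  then show ?case by simp
next
  case (insert x S)
  have 1: "Sigma (insert x S) B = Pair x ` B x \<union> Sigma S B" by auto
  have "(\<Oplus>p\<in>Sigma (insert x S) B. case p of (x, y) \<Rightarrow> h x y)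
      = (\<Oplus>p\<in>Pair x ` B x. case p of (x, y) \<Rightarrow> h x y) \<oplus> (\<Oplus>p\<in>Sigma S B. case p of (x, y) \<Rightarrow> h x y)"
    unfolding 1 using insert.hyps insert.prems by (intro finsum_Un_disjoint) auto
  also have "(\<Oplus>p\<in>Pair x ` B x. case p of (x, y) \<Rightarrow> h x y) = (\<Oplus>y\<in>B x. h x y)"
    using insert.prems by (subst finsum_reindex) (auto simp: inj_on_def)
  finally show ?case
    using insert by (subst finsum_insert) auto
qed

lemma (in ideal) finsum_mem:
  assumes "\<And>x. x \<in> S \<Longrightarrow> h x \<in> I"
  shows "finsum R h S \<in> I"
  using assms
proof (induction S rule: infinite_finite_induct)
  case (insert x S)
  then show ?case using Icarr by (subst finsum_insert) auto
qed auto

context cring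
begin

lemma poly_alg_carrier:
  "f \<in> carrier (poly_alg R I) \<longleftrightarrow>
    (\<forall>\<mu>. f \<mu> \<in> carrier R) \<and> finite {\<mu>. f \<mu> \<noteq> \<zero>} \<and> {\<mu>. f \<mu> \<noteq> \<zero>} \<subseteq> exponents I"
  by (simp add: poly_alg_def)

lemma poly_alg_simps:
  "\<zero>\<^bsub>poly_alg R I\<^esub> = (\<lambda>\<mu>. \<zero>)"
  "f \<oplus>\<^bsub>poly_alg R I\<^esub> g = (\<lambda>\<mu>. f \<mu> \<oplus> g \<mu>)"
  "\<one>\<^bsub>poly_alg R I\<^esub> = (\<lambda>\<mu>. if \<mu> = 0 then \<one> else \<zero>)"
  "f \<otimes>\<^bsub>poly_alg R I\<^esub> g = (\<lambda>\<mu>. \<Oplus>p\<in>{(\<alpha>, \<beta>). \<alpha> + \<beta> = \<mu>}. case p of (\<alpha>, \<beta>) \<Rightarrow> f \<alpha> \<otimes> g \<beta>)"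
  by (simp_all add: poly_alg_def)

lemma coeff_closed: "f \<in> carrier (poly_alg R I) \<Longrightarrow> f \<mu> \<in> carrier R"
  by (simp add: poly_alg_carrier)

text \<open>The choice of the ideal gives different facts: the zero ideal shows that a coefficient
  vanishes, the unit ideal that it lies in the ring, and powers of an ideal control the coefficients
  of products.\<close>

lemma poly_mult_coeff_mem:
  assumes "ideal C R" "\<And>\<alpha> \<beta>. \<alpha> + \<beta> = \<mu> \<Longrightarrow> f \<alpha> \<otimes> g \<beta> \<in> C"
  shows "(f \<otimes>\<^bsub>poly_alg R I\<^esub> g) \<mu> \<in> C"
  unfolding poly_alg_simps using assms by (auto intro!: ideal.finsum_mem)

lemma poly_mult_comm:
  fixes f :: "('i, 'a) mpoly"
  assumes "f \<in> carrier (poly_alg R I)" "g \<in> carrier (poly_alg R I)"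
  shows "f \<otimes>\<^bsub>poly_alg R I\<^esub> g = g \<otimes>\<^bsub>poly_alg R I\<^esub> f"
proof
  fix \<mu> :: "'i \<Rightarrow>\<^sub>0 nat"
  have eq: "{(\<alpha>, \<beta>). \<alpha> + \<beta> = \<mu>} = prod.swap ` {(\<alpha>, \<beta>). \<alpha> + \<beta> = \<mu>}"
    by (auto simp: image_iff ab_semigroup_add_class.add.commute)
  have "(\<Oplus>p\<in>{(\<alpha>, \<beta>). \<alpha> + \<beta> = \<mu>}. case p of (\<alpha>, \<beta>) \<Rightarrow> f \<alpha> \<otimes> g \<beta>)
      = (\<Oplus>p\<in>prod.swap ` {(\<alpha>, \<beta>). \<alpha> + \<beta> = \<mu>}. case p of (\<alpha>, \<beta>) \<Rightarrow> f \<alpha> \<otimes> g \<beta>)"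
    using eq by simp
  also have "\<dots> = (\<Oplus>p\<in>{(\<alpha>, \<beta>). \<alpha> + \<beta> = \<mu>}. case prod.swap p of (\<alpha>, \<beta>) \<Rightarrow> f \<alpha> \<otimes> g \<beta>)"
    using assms by (subst finsum_reindex) (auto simp: coeff_closed)
  also have "\<dots> = (\<Oplus>p\<in>{(\<alpha>, \<beta>). \<alpha> + \<beta> = \<mu>}. case p of (\<alpha>, \<beta>) \<Rightarrow> g \<alpha> \<otimes> f \<beta>)"
    using assms by (intro finsum_cong') (auto simp: coeff_closed intro!: m_comm)
  finally show "(f \<otimes>\<^bsub>poly_alg R I\<^esub> g) \<mu> = (g \<otimes>\<^bsub>poly_alg R I\<^esub> f) \<mu>"
    by (simp add: poly_alg_simps)
qed

lemma poly_mult_closed: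
  assumes f: "f \<in> carrier (poly_alg R I)" and g: "g \<in> carrier (poly_alg R I)"
  shows "f \<otimes>\<^bsub>poly_alg R I\<^esub> g \<in> carrier (poly_alg R I)"
proof -
  have supp: "{\<mu>. (f \<otimes>\<^bsub>poly_alg R I\<^esub> g) \<mu> \<noteq> \<zero>}
      \<subseteq> (\<lambda>(\<alpha>, \<beta>). \<alpha> + \<beta>) ` ({\<mu>. f \<mu> \<noteq> \<zero>} \<times> {\<mu>. g \<mu> \<noteq> \<zero>})"
  proof
    fix \<mu> assume "\<mu> \<in> {\<mu>. (f \<otimes>\<^bsub>poly_alg R I\<^esub> g) \<mu> \<noteq> \<zero>}"
    then have "\<not> (\<forall>\<alpha> \<beta>. \<alpha> + \<beta> = \<mu> \<longrightarrow> f \<alpha> \<otimes> g \<beta> = \<zero>)"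
      using poly_mult_coeff_mem[OF zeroideal, of \<mu> f g I] by auto
    then show "\<mu> \<in> (\<lambda>(\<alpha>, \<beta>). \<alpha> + \<beta>) ` ({\<mu>. f \<mu> \<noteq> \<zero>} \<times> {\<mu>. g \<mu> \<noteq> \<zero>})"
      using f g by (force simp: coeff_closed image_iff)
  qed
  moreover have "finite ((\<lambda>(\<alpha>, \<beta>). \<alpha> + \<beta>) ` ({\<mu>. f \<mu> \<noteq> \<zero>} \<times> {\<mu>. g \<mu> \<noteq> \<zero>}))"
    using f g by (simp add: poly_alg_carrier)
  moreover have "(\<lambda>(\<alpha>, \<beta>). \<alpha> + \<beta>) ` ({\<mu>. f \<mu> \<noteq> \<zero>} \<times> {\<mu>. g \<mu> \<noteq> \<zero>}) \<subseteq> exponents I"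
    using f g by (auto simp: poly_alg_carrier exponents_add_iff)
  moreover have "(f \<otimes>\<^bsub>poly_alg R I\<^esub> g) \<mu> \<in> carrier R" for \<mu>
    using f g by (intro poly_mult_coeff_mem oneideal) (simp add: coeff_closed)
  ultimately show ?thesis
    unfolding poly_alg_carrier by (meson finite_subset order_trans)
qed

text \<open>The index set on the right no longer remembers the bracketing, so it can be permuted
  freely.\<close>

lemma poly_mult_triple:
  fixes f :: "('i, 'a) mpoly"
  assumes f: "f \<in> carrier (poly_alg R I)" and g: "g \<in> carrier (poly_alg R I)"
    and h: "h \<in> carrier (poly_alg R I)"
  shows "(f \<otimes>\<^bsub>poly_alg R I\<^esub> g \<otimes>\<^bsub>poly_alg R I\<^esub> h) \<mu> =
    (\<Oplus>p\<in>{(\<alpha>, \<beta>, \<gamma>). \<alpha> + \<beta> + \<gamma> = \<mu>}. case p of (\<alpha>, \<beta>, \<gamma>) \<Rightarrow> f \<alpha> \<otimes> g \<beta> \<otimes> h \<gamma>)"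
proof -
  let ?Q = "\<lambda>\<mu>. {(\<alpha>, \<beta>). \<alpha> + \<beta> = (\<mu> :: 'i \<Rightarrow>\<^sub>0 nat)}"
  let ?S = "Sigma (?Q \<mu>) (\<lambda>p. ?Q (fst p))"
  let ?F = "\<lambda>p q. f (fst q) \<otimes> g (snd q) \<otimes> h (snd p)"
  \<comment> \<open>A triple corresponds to a splitting of \<mu> into two parts together with a
    splitting of the first part.\<close>
  let ?H = "\<lambda>(\<alpha> :: 'i \<Rightarrow>\<^sub>0 nat, \<beta> :: 'i \<Rightarrow>\<^sub>0 nat, \<gamma> :: 'i \<Rightarrow>\<^sub>0 nat). ((\<alpha> + \<beta>, \<gamma>), (\<alpha>, \<beta>))"
  note cl = f[THEN coeff_closed] g[THEN coeff_closed] h[THEN coeff_closed]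
  have S: "?S = ?H ` {(\<alpha>, \<beta>, \<gamma>). \<alpha> + \<beta> + \<gamma> = \<mu>}"
    by (auto simp: image_iff)
  have "(f \<otimes>\<^bsub>poly_alg R I\<^esub> g \<otimes>\<^bsub>poly_alg R I\<^esub> h) \<mu> = (\<Oplus>p\<in>?Q \<mu>. \<Oplus>q\<in>?Q (fst p). ?F p q)"
    unfolding poly_alg_simps
    by (rule finsum_cong')
       (auto simp: cl finite_sum_pairs finite_sum_pairs[unfolded split_def] split_def
         intro!: finsum_closed finsum_cong' finsum_ldistr)
  also have "\<dots> = (\<Oplus>t\<in>?S. case t of (p, q) \<Rightarrow> ?F p q)"
    by (rule finsum_Sigma) (auto simp: finite_sum_pairs cl)
  also have "\<dots> = (\<Oplus>t\<in>{(\<alpha>, \<beta>, \<gamma>). \<alpha> + \<beta> + \<gamma> = \<mu>}. case ?H t of (p, q) \<Rightarrow> ?F p q)"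
    unfolding S by (rule finsum_reindex) (auto simp: cl inj_on_def)
  also have "\<dots> = (\<Oplus>p\<in>{(\<alpha>, \<beta>, \<gamma>). \<alpha> + \<beta> + \<gamma> = \<mu>}. case p of (\<alpha>, \<beta>, \<gamma>) \<Rightarrow> f \<alpha> \<otimes> g \<beta> \<otimes> h \<gamma>)"
    by (rule finsum_cong') (auto simp: cl)
  finally show ?thesis .
qed

text \<open>Commutativity turns \<open>f (g h)\<close> into \<open>(g h) f\<close>, so that both
  sides are left-bracketed triple products; they differ by a cyclic rotation of the index
  triples.\<close>

lemma poly_mult_assoc:
  fixes f :: "('i, 'a) mpoly"
  assumes f: "f \<in> carrier (poly_alg R I)" and g: "g \<in> carrier (poly_alg R I)"
    and h: "h \<in> carrier (poly_alg R I)"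
  shows "f \<otimes>\<^bsub>poly_alg R I\<^esub> g \<otimes>\<^bsub>poly_alg R I\<^esub> h = f \<otimes>\<^bsub>poly_alg R I\<^esub> (g \<otimes>\<^bsub>poly_alg R I\<^esub> h)"
proof
  fix \<mu> :: "'i \<Rightarrow>\<^sub>0 nat"
  let ?T = "{(\<alpha>, \<beta>, \<gamma>). \<alpha> + \<beta> + \<gamma> = \<mu>}"
  let ?r = "\<lambda>(\<alpha> :: 'i \<Rightarrow>\<^sub>0 nat, \<beta> :: 'i \<Rightarrow>\<^sub>0 nat, \<gamma> :: 'i \<Rightarrow>\<^sub>0 nat). (\<gamma>, \<alpha>, \<beta>)"
  note cl = f[THEN coeff_closed] g[THEN coeff_closed] h[THEN coeff_closed]
  have T: "?T = ?r ` ?T"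
  proof (intro equalityI subsetI)
    fix t assume "t \<in> ?T"
    then obtain a b c where "t = (a, b, c)" "a + b + c = \<mu>" by auto
    then have "t = ?r (b, c, a)" "(b, c, a) \<in> ?T" by (auto simp: ac_simps)
    then show "t \<in> ?r ` ?T" by blast
  qed (auto simp: ac_simps)
  have "(f \<otimes>\<^bsub>poly_alg R I\<^esub> (g \<otimes>\<^bsub>poly_alg R I\<^esub> h)) \<mu>
      = (g \<otimes>\<^bsub>poly_alg R I\<^esub> h \<otimes>\<^bsub>poly_alg R I\<^esub> f) \<mu>"
    using poly_mult_comm[OF f poly_mult_closed[OF g h]] by simp
  also have "\<dots> = (\<Oplus>p\<in>?T. case p of (\<alpha>, \<beta>, \<gamma>) \<Rightarrow> g \<alpha> \<otimes> h \<beta> \<otimes> f \<gamma>)"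
    by (rule poly_mult_triple[OF g h f])
  also have "\<dots> = (\<Oplus>t\<in>?T. case ?r t of (\<alpha>, \<beta>, \<gamma>) \<Rightarrow> f \<alpha> \<otimes> g \<beta> \<otimes> h \<gamma>)"
    by (rule finsum_cong') (auto simp: cl m_ac)
  also have "\<dots> = (\<Oplus>p\<in>?r ` ?T. case p of (\<alpha>, \<beta>, \<gamma>) \<Rightarrow> f \<alpha> \<otimes> g \<beta> \<otimes> h \<gamma>)"
    by (rule finsum_reindex[symmetric]) (auto simp: cl inj_on_def)
  also have "\<dots> = (f \<otimes>\<^bsub>poly_alg R I\<^esub> g \<otimes>\<^bsub>poly_alg R I\<^esub> h) \<mu>"
    using T poly_mult_triple[OF f g h] by simp
  finally show "(f \<otimes>\<^bsub>poly_alg R I\<^esub> g \<otimes>\<^bsub>poly_alg R I\<^esub> h) \<mu>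
      = (f \<otimes>\<^bsub>poly_alg R I\<^esub> (g \<otimes>\<^bsub>poly_alg R I\<^esub> h)) \<mu>" by simp
qed

section \<open>Terms with one coefficient, and the ring axioms\<close>

text \<open>The term \<open>c X^\<mu>\<close>, given by its coefficients instead of as a product of
  variables.\<close>

definition cmonom :: "'a \<Rightarrow> ('i \<Rightarrow>\<^sub>0 nat) \<Rightarrow> ('i, 'a) mpoly" where
  "cmonom c \<mu> = (\<lambda>\<nu>. if \<nu> = \<mu> then c else \<zero>)"

lemma cmonom_closed: "c \<in> carrier R \<Longrightarrow> \<mu> \<in> exponents I \<Longrightarrow> cmonom c \<mu> \<in> carrier (poly_alg R I)"
  by (auto simp: poly_alg_carrier cmonom_def)

lemma one_poly: "\<one>\<^bsub>poly_alg R I\<^esub> = cmonom \<one> 0"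
  by (simp add: poly_alg_simps cmonom_def)

text \<open>By cancellation, \<open>(\<alpha>, \<beta>)\<close> is the only pair with this sum and
  first component \<alpha>; every other summand has a zero factor.\<close>

lemma cmonom_mult_coeff:
  assumes "c \<in> carrier R" "f \<in> carrier (poly_alg R I)"
  shows "(cmonom c \<alpha> \<otimes>\<^bsub>poly_alg R I\<^esub> f) (\<alpha> + \<beta>) = c \<otimes> f \<beta>"
proof -
  have "(cmonom c \<alpha> \<otimes>\<^bsub>poly_alg R I\<^esub> f) (\<alpha> + \<beta>)
      = (\<Oplus>p\<in>{(\<gamma>, \<delta>). \<gamma> + \<delta> = \<alpha> + \<beta>}. if (\<alpha>, \<beta>) = p then c \<otimes> f (snd p) else \<zero>)"
    unfolding poly_alg_simps using assms
    by (intro finsum_cong') (auto simp: coeff_closed cmonom_def split: if_splits)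
  also have "\<dots> = c \<otimes> f \<beta>"
    using finsum_singleton[of "(\<alpha>, \<beta>)" "{(\<gamma>, \<delta>). \<gamma> + \<delta> = \<alpha> + \<beta>}" "\<lambda>p. c \<otimes> f (snd p)"] assms
    by (simp add: finite_sum_pairs coeff_closed)
  finally show ?thesis .
qed

lemma cmonom_mult:
  assumes "c \<in> carrier R" "d \<in> carrier R" "\<beta> \<in> exponents I"
  shows "cmonom c \<alpha> \<otimes>\<^bsub>poly_alg R I\<^esub> cmonom d \<beta> = cmonom (c \<otimes> d) (\<alpha> + \<beta>)"
proof
  fix \<mu>
  show "(cmonom c \<alpha> \<otimes>\<^bsub>poly_alg R I\<^esub> cmonom d \<beta>) \<mu> = cmonom (c \<otimes> d) (\<alpha> + \<beta>) \<mu>"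
  proof (cases "\<mu> = \<alpha> + \<beta>")
    case True
    with assms show ?thesis
      using cmonom_mult_coeff[OF assms(1) cmonom_closed[OF assms(2,3)], of \<alpha> \<beta>]
      by (simp add: cmonom_def)
  next
    case False
    have "(cmonom c \<alpha> \<otimes>\<^bsub>poly_alg R I\<^esub> cmonom d \<beta>) \<mu> \<in> {\<zero>}"
      using False assms by (intro poly_mult_coeff_mem zeroideal) (auto simp: cmonom_def)
    with False show ?thesis by (simp add: cmonom_def)
  qed
qed

lemma poly_l_one:
  assumes "f \<in> carrier (poly_alg R I)"
  shows "\<one>\<^bsub>poly_alg R I\<^esub> \<otimes>\<^bsub>poly_alg R I\<^esub> f = f"
  using cmonom_mult_coeff[OF one_closed assms, of 0] assms
  by (auto simp: one_poly coeff_closed)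

lemma poly_l_distr:
  assumes "f \<in> carrier (poly_alg R I)" "g \<in> carrier (poly_alg R I)" "h \<in> carrier (poly_alg R I)"
  shows "(f \<oplus>\<^bsub>poly_alg R I\<^esub> g) \<otimes>\<^bsub>poly_alg R I\<^esub> h =
    f \<otimes>\<^bsub>poly_alg R I\<^esub> h \<oplus>\<^bsub>poly_alg R I\<^esub> g \<otimes>\<^bsub>poly_alg R I\<^esub> h"
proof -
  note cl = assms[THEN coeff_closed]
  show ?thesis
    unfolding poly_alg_simps
    by (rule ext, subst finsum_addf[symmetric])
       (auto simp: cl l_distr split_def intro!: finsum_cong')
qed

lemma poly_add_closed:
  assumes "f \<in> carrier (poly_alg R I)" "g \<in> carrier (poly_alg R I)"
  shows "f \<oplus>\<^bsub>poly_alg R I\<^esub> g \<in> carrier (poly_alg R I)"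
proof -
  have "{\<mu>. f \<mu> \<oplus> g \<mu> \<noteq> \<zero>} \<subseteq> {\<mu>. f \<mu> \<noteq> \<zero>} \<union> {\<mu>. g \<mu> \<noteq> \<zero>}" by auto
  with assms show ?thesis
    unfolding poly_alg_carrier poly_alg_simps
    by (auto intro: finite_subset)
qed

lemma poly_uminus_closed:
  assumes "f \<in> carrier (poly_alg R I)"
  shows "(\<lambda>\<mu>. \<ominus> f \<mu>) \<in> carrier (poly_alg R I)"
proof -
  have "{\<mu>. \<ominus> f \<mu> \<noteq> \<zero>} \<subseteq> {\<mu>. f \<mu> \<noteq> \<zero>}" by auto
  with assms show ?thesis
    unfolding poly_alg_carrier by (auto intro: finite_subset)
qed

lemma poly_alg_cring: "cring (poly_alg R I)"
proof (rule cringI)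
  show "abelian_group (poly_alg R I)"
  proof (rule abelian_groupI)
    fix f assume f: "f \<in> carrier (poly_alg R I)"
    show "\<exists>g\<in>carrier (poly_alg R I). g \<oplus>\<^bsub>poly_alg R I\<^esub> f = \<zero>\<^bsub>poly_alg R I\<^esub>"
      using f[THEN coeff_closed]
      by (intro bexI[OF _ poly_uminus_closed[OF f]]) (auto simp: poly_alg_simps l_neg)
  qed (auto simp: poly_add_closed, auto simp: poly_alg_simps poly_alg_carrier a_ac)
  show "comm_monoid (poly_alg R I)"
    by (rule comm_monoidI)
       (auto simp: poly_mult_closed one_poly cmonom_closed exponents_def
         intro: poly_mult_assoc poly_mult_comm poly_l_one[unfolded one_poly])
qed (rule poly_l_distr)

end

section \<open>Monomial ideals\<close>

text \<open>The exponents of all monomial multiples of the \<open>X^s\<close>. It is not cut down to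
  \<open>exponents I\<close>; membership in the carrier of \<open>poly_alg\<close> does
  that.\<close>

definition upward_closure :: "('i \<Rightarrow>\<^sub>0 nat) set \<Rightarrow> ('i \<Rightarrow>\<^sub>0 nat) set" where
  "upward_closure S = {\<mu>. \<exists>s\<in>S. \<exists>\<delta>. \<mu> = s + \<delta>}"

lemma upward_closure_add: "\<mu> \<in> upward_closure S \<Longrightarrow> \<mu> + \<delta> \<in> upward_closure S"
proof -
  assume "\<mu> \<in> upward_closure S"
  then obtain s \<gamma> where "s \<in> S" "\<mu> + \<delta> = s + (\<gamma> + \<delta>)"
    by (auto simp: upward_closure_def add.assoc)
  then show "\<mu> + \<delta> \<in> upward_closure S" unfolding upward_closure_def by blast
qed

lemma upward_closure_superset: "S \<subseteq> upward_closure S"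
proof
  fix s assume "s \<in> S"
  moreover have "s = s + 0" by simp
  ultimately show "s \<in> upward_closure S" unfolding upward_closure_def by blast
qed

lemma upward_closure_subset:
  assumes "S \<subseteq> upward_closure T"
  shows "upward_closure S \<subseteq> upward_closure T"
proof
  fix \<mu> assume "\<mu> \<in> upward_closure S"
  then obtain s \<delta> where "s \<in> S" "\<mu> = s + \<delta>" by (auto simp: upward_closure_def)
  with assms show "\<mu> \<in> upward_closure T" by (auto intro: upward_closure_add)
qed

lemma add_eq_0_poly_mapping_nat: "\<alpha> + \<beta> = (0 :: 'i \<Rightarrow>\<^sub>0 nat) \<Longrightarrow> \<beta> = 0"
  by (metis keys_add_nat keys_eq_empty Un_empty)

lemma mem_upward_closure_le:
  assumes "e \<in> S" "\<And>i. Poly_Mapping.lookup e i \<le> Poly_Mapping.lookup \<mu> i"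
  shows "\<mu> \<in> upward_closure S"
proof -
  have "\<mu> = e + (\<mu> - e)"
    using assms(2)
    by (intro poly_mapping_eqI) (simp add: Poly_Mapping.lookup_add Poly_Mapping.lookup_minus)
  then have "\<exists>\<delta>. \<mu> = e + \<delta>" by (rule exI)
  with assms(1) show ?thesis unfolding upward_closure_def by (simp add: bexI)
qed

definition minimal_exponents :: "('i \<Rightarrow>\<^sub>0 nat) set \<Rightarrow> ('i \<Rightarrow>\<^sub>0 nat) set" where
  "minimal_exponents S = {m \<in> S. \<forall>s\<in>S. \<forall>\<delta>. m = s + \<delta> \<longrightarrow> \<delta> = 0}"

text \<open>An exponent has finitely many divisors, and strictly fewer remain on passing to a proper
  divisor. The descent therefore terminates even for infinite \<open>S\<close> and infinitely many
  variables.\<close>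

lemma subset_upward_closure_minimal: "S \<subseteq> upward_closure (minimal_exponents S)"
proof
  let ?D = "\<lambda>\<mu> :: 'a \<Rightarrow>\<^sub>0 nat. {(\<alpha>, \<beta>). \<alpha> + \<beta> = \<mu>}"
  fix \<mu> assume "\<mu> \<in> S"
  then show "\<mu> \<in> upward_closure (minimal_exponents S)"
  proof (induction "card (fst ` ?D \<mu>)" arbitrary: \<mu> rule: less_induct)
    case less
    show ?case
    proof (cases "\<mu> \<in> minimal_exponents S")
      case True
      then show ?thesis using upward_closure_superset by blast
    next
      case False
      with less.prems obtain s \<delta> where s: "s \<in> S" "\<mu> = s + \<delta>" "\<delta> \<noteq> 0"
        by (auto simp: minimal_exponents_def)
      have "fst ` ?D s \<subseteq> fst ` ?D \<mu>"
      proof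
        fix \<alpha> assume "\<alpha> \<in> fst ` ?D s"
        then obtain \<beta> where "\<alpha> + \<beta> = s" by auto
        then have "(\<alpha>, \<beta> + \<delta>) \<in> ?D \<mu>" using s(2) by (auto simp flip: add.assoc)
        then show "\<alpha> \<in> fst ` ?D \<mu>" by (rule rev_image_eqI) simp
      qed
      moreover have "\<mu> \<in> fst ` ?D \<mu>" by (rule image_eqI[of _ _ "(\<mu>, 0)"]) auto
      moreover have "\<mu> \<notin> fst ` ?D s"
      proof
        assume "\<mu> \<in> fst ` ?D s"
        then obtain \<beta> where "s + \<delta> + \<beta> = s" using s(2) by auto
        then have "s + (\<beta> + \<delta>) = s" by (simp add: ac_simps)
        then have "\<beta> + \<delta> = 0" by simp
        with s(3) show False using add_eq_0_poly_mapping_nat by blast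
      qed
      ultimately have "card (fst ` ?D s) < card (fst ` ?D \<mu>)"
        by (intro psubset_card_mono finite_imageI finite_sum_pairs) blast
      from less.hyps[OF this s(1)] s(2) show ?thesis by (simp add: upward_closure_add)
    qed
  qed
qed

text \<open>A minimal \<open>m\<close> of \<open>S\<close> lies above some \<open>e\<close> in
  \<open>E\<close>, which lies above some \<open>s\<close> in \<open>S\<close>; minimality collapses
  this chain to \<open>m = e\<close>. Hence every monomial generating set contains the minimal
  one.\<close>

lemma minimal_exponents_subset:
  assumes "E \<subseteq> upward_closure S" "S \<subseteq> upward_closure E"
  shows "minimal_exponents S \<subseteq> E"
proof
  fix m assume m: "m \<in> minimal_exponents S"
  then have "m \<in> upward_closure E" using assms(2) by (auto simp: minimal_exponents_def)
  then obtain e \<delta> where e: "e \<in> E" "m = e + \<delta>" by (auto simp: upward_closure_def)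
  then obtain s \<delta>' where s: "s \<in> S" "e = s + \<delta>'" using assms(1) by (auto simp: upward_closure_def)
  have "m = s + (\<delta>' + \<delta>)" using e s by (simp add: add.assoc)
  with m s have "\<delta>' + \<delta> = 0" by (auto simp: minimal_exponents_def)
  then have "\<delta> = 0" by (rule add_eq_0_poly_mapping_nat)
  with e show "m \<in> E" by simp
qed

section \<open>Supports and squarefree exponents\<close>

definition support_exponent :: "('i \<Rightarrow>\<^sub>0 nat) \<Rightarrow> ('i \<Rightarrow>\<^sub>0 nat)" where
  "support_exponent \<mu> = (\<Sum>i\<in>Poly_Mapping.keys \<mu>. Poly_Mapping.single i 1)"

lemma lookup_sum_single:
  "finite K \<Longrightarrow> Poly_Mapping.lookup (\<Sum>i\<in>K. Poly_Mapping.single i (h i)) j =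
    (if j \<in> K then h j else (0 :: nat))"
  by (simp add: lookup_sum lookup_single when_def)

lemma sum_single_lookup: "(\<Sum>i\<in>Poly_Mapping.keys \<mu>. Poly_Mapping.single i (Poly_Mapping.lookup \<mu> i)) = (\<mu> :: 'i \<Rightarrow>\<^sub>0 nat)"
  by (rule poly_mapping_eqI) (simp add: lookup_sum_single in_keys_iff)

lemma lookup_support_exponent:
  "Poly_Mapping.lookup (support_exponent \<mu>) i = (if i \<in> Poly_Mapping.keys \<mu> then 1 else 0)"
  by (simp add: support_exponent_def lookup_sum_single)

lemma keys_support_exponent: "Poly_Mapping.keys (support_exponent \<mu>) = Poly_Mapping.keys \<mu>"
  by (auto simp: in_keys_iff lookup_support_exponent split: if_splits)

lemma support_exponent_exponents:
  "\<mu> \<in> exponents I \<Longrightarrow> support_exponent \<mu> \<in> exponents I"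
  by (simp add: exponents_def keys_support_exponent)

text \<open>Divisibility by a squarefree monomial depends on supports only. Since \<mu> and
  \<open>\<mu> + \<mu>\<close> have the same support, the set is closed under halving, which the
  argument on squares requires.\<close>

lemma mem_upward_closure_support:
  "\<mu> \<in> upward_closure (support_exponent ` E) \<longleftrightarrow> (\<exists>e\<in>E. Poly_Mapping.keys e \<subseteq> Poly_Mapping.keys \<mu>)"
proof
  assume "\<mu> \<in> upward_closure (support_exponent ` E)"
  then obtain e \<delta> where "e \<in> E" "\<mu> = support_exponent e + \<delta>"
    by (auto simp: upward_closure_def)
  moreover from this have "Poly_Mapping.keys e \<subseteq> Poly_Mapping.keys \<mu>"
    by (simp add: keys_add_nat keys_support_exponent)
  ultimately show "\<exists>e\<in>E. Poly_Mapping.keys e \<subseteq> Poly_Mapping.keys \<mu>" by blast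
next
  assume "\<exists>e\<in>E. Poly_Mapping.keys e \<subseteq> Poly_Mapping.keys \<mu>"
  then obtain e where e: "e \<in> E" "Poly_Mapping.keys e \<subseteq> Poly_Mapping.keys \<mu>" by blast
  have "\<mu> \<in> upward_closure {support_exponent e}"
  proof (rule mem_upward_closure_le)
    fix i
    show "Poly_Mapping.lookup (support_exponent e) i \<le> Poly_Mapping.lookup \<mu> i"
    proof (cases "i \<in> Poly_Mapping.keys e")
      case True
      then have "i \<in> Poly_Mapping.keys \<mu>" using e(2) by blast
      then show ?thesis by (simp add: lookup_support_exponent in_keys_iff)
    qed (simp add: lookup_support_exponent)
  qed simp
  with e(1) show "\<mu> \<in> upward_closure (support_exponent ` E)"
    unfolding upward_closure_def by blast
qed

lemma (in ideal) zero_mem: "\<zero> \<in> I" by simp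

context cring
begin

section \<open>Ideals cut out by conditions on coefficients\<close>

text \<open>One format for all ideals to be compared: a monomial ideal has \<open>C\<close> equal to
  the ring on an upward closed set and zero elsewhere, \<open>N R\<close> has \<open>C\<close>
  constantly N, and \<open>L + N R\<close> has the ring on the set of L and N elsewhere.\<close>

definition coeff_ideal :: "'i set \<Rightarrow> (('i \<Rightarrow>\<^sub>0 nat) \<Rightarrow> 'a set) \<Rightarrow> ('i, 'a) mpoly set" where
  "coeff_ideal I C = {f \<in> carrier (poly_alg R I). \<forall>\<mu>. f \<mu> \<in> C \<mu>}"

lemma poly_uminus:
  assumes "f \<in> carrier (poly_alg R I)"
  shows "\<ominus>\<^bsub>poly_alg R I\<^esub> f = (\<lambda>\<mu>. \<ominus> f \<mu>)"
proof -
  interpret P: cring "poly_alg R I" by (rule poly_alg_cring)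
  show ?thesis
    using assms[THEN coeff_closed]
    by (intro P.minus_equality poly_uminus_closed assms) (auto simp: poly_alg_simps l_neg)
qed

text \<open>Monotonicity of \<open>C\<close> is what multiplication needs: a product of a
  coefficient at \<alpha> with one at \<beta> lies in \<open>C \<beta>\<close>, and it contributes
  at \<open>\<alpha> + \<beta>\<close>.\<close>

lemma coeff_ideal_ideal:
  fixes C :: "('i \<Rightarrow>\<^sub>0 nat) \<Rightarrow> 'a set"
  assumes C: "\<And>\<mu>. ideal (C \<mu>) R" and mono: "\<And>\<alpha> \<beta>. C \<alpha> \<subseteq> C (\<alpha> + \<beta>)"
  shows "ideal (coeff_ideal I C) (poly_alg R I)"
proof -
  interpret P: cring "poly_alg R I :: ('i, 'a) mpoly ring" by (rule poly_alg_cring)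
  have l: "g \<otimes>\<^bsub>poly_alg R I\<^esub> f \<in> coeff_ideal I C"
    if "f \<in> coeff_ideal I C" "g \<in> carrier (poly_alg R I)" for f g
    unfolding coeff_ideal_def
  proof (intro CollectI conjI allI)
    fix \<mu>
    show "(g \<otimes>\<^bsub>poly_alg R I\<^esub> f) \<mu> \<in> C \<mu>"
    proof (rule poly_mult_coeff_mem[OF C])
      fix \<alpha> \<beta> :: "'i \<Rightarrow>\<^sub>0 nat" assume "\<alpha> + \<beta> = \<mu>"
      then have "C \<beta> \<subseteq> C \<mu>" using mono[of \<beta> \<alpha>] by (simp add: ab_semigroup_add_class.add.commute)
      moreover have "g \<alpha> \<otimes> f \<beta> \<in> C \<beta>"
        using that by (intro ideal.I_l_closed[OF C]) (auto simp: coeff_ideal_def coeff_closed)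
      ultimately show "g \<alpha> \<otimes> f \<beta> \<in> C \<mu>" by blast
    qed
  qed (use that in \<open>auto simp: coeff_ideal_def\<close>)
  show ?thesis
  proof (rule idealI)
    show "subgroup (coeff_ideal I C) (add_monoid (poly_alg R I))"
    proof (rule P.add.subgroupI)
      show "coeff_ideal I C \<subseteq> carrier (poly_alg R I)" by (auto simp: coeff_ideal_def)
      have "\<zero>\<^bsub>poly_alg R I\<^esub> \<in> coeff_ideal I C"
        using ideal.zero_mem[OF C] by (simp add: coeff_ideal_def) (simp add: poly_alg_simps)
      then show "coeff_ideal I C \<noteq> {}" by blast
    next
      fix f assume "f \<in> coeff_ideal I C"
      then show "\<ominus>\<^bsub>poly_alg R I\<^esub> f \<in> coeff_ideal I C"
        using C
        by (auto simp: coeff_ideal_def poly_uminus poly_uminus_closed ideal_def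
            additive_subgroup.a_inv_closed)
    next
      fix f g assume "f \<in> coeff_ideal I C" "g \<in> coeff_ideal I C"
      then show "f \<oplus>\<^bsub>poly_alg R I\<^esub> g \<in> coeff_ideal I C"
        using C
        by (auto simp: coeff_ideal_def poly_add_closed)
           (auto simp: poly_alg_simps ideal_def additive_subgroup.a_closed)
    qed
    fix f g assume "f \<in> coeff_ideal I C" "g \<in> carrier (poly_alg R I)"
    then show "g \<otimes>\<^bsub>poly_alg R I\<^esub> f \<in> coeff_ideal I C" by (rule l)
    then show "f \<otimes>\<^bsub>poly_alg R I\<^esub> g \<in> coeff_ideal I C"
      using poly_mult_comm[of f I g] \<open>f \<in> _\<close> \<open>g \<in> _\<close> by (simp add: coeff_ideal_def)
  qed (rule P.ring_axioms)
qed

definition monomial_coeffs :: "('i \<Rightarrow>\<^sub>0 nat) set \<Rightarrow> ('i \<Rightarrow>\<^sub>0 nat) \<Rightarrow> 'a set" where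
  "monomial_coeffs U \<mu> = (if \<mu> \<in> U then carrier R else {\<zero>})"

lemma monomial_coeffs_ideal: "ideal (coeff_ideal I (monomial_coeffs (upward_closure S))) (poly_alg R I)"
  by (rule coeff_ideal_ideal)
     (auto simp: monomial_coeffs_def oneideal zeroideal upward_closure_add)

lemma mem_ideal_of_monomials:
  fixes f :: "('i, 'a) mpoly"
  assumes "ideal T (poly_alg R I)" "f \<in> carrier (poly_alg R I)"
    and "\<And>\<mu>. f \<mu> \<noteq> \<zero> \<Longrightarrow> cmonom (f \<mu>) \<mu> \<in> T"
  shows "f \<in> T"
proof -
  interpret T: ideal T "poly_alg R I" by fact
  \<comment> \<open>A polynomial is the finite sum of its terms; \<open>f\<close> is generalised so
    that the induction hypothesis applies after deletion of one term.\<close>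
  have "f \<in> T" if "finite F" "{\<mu>. f \<mu> \<noteq> \<zero>} = F" "f \<in> carrier (poly_alg R I)"
      "\<And>\<mu>. f \<mu> \<noteq> \<zero> \<Longrightarrow> cmonom (f \<mu>) \<mu> \<in> T" for F f
    using that
  proof (induction F arbitrary: f rule: finite_induct)
    case empty
    then have "f = \<zero>\<^bsub>poly_alg R I\<^esub>" by (auto simp: poly_alg_simps)
    then show ?case by simp
  next
    case (insert \<mu> F)
    let ?g = "\<lambda>\<nu>. if \<nu> = \<mu> then \<zero> else f \<nu>"
    have supp: "{\<nu>. ?g \<nu> \<noteq> \<zero>} = {\<nu>. f \<nu> \<noteq> \<zero>} - {\<mu>}" by auto
    then have 1: "{\<nu>. ?g \<nu> \<noteq> \<zero>} = F" using insert.hyps(2) unfolding insert.prems(1) by simp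
    have 2: "?g \<in> carrier (poly_alg R I)"
      using insert.prems(2) unfolding poly_alg_carrier supp by auto
    have 3: "cmonom (?g \<nu>) \<nu> \<in> T" if "?g \<nu> \<noteq> \<zero>" for \<nu>
      using that insert.prems(3)[of \<nu>] by (simp split: if_splits)
    have g: "?g \<in> T" by (rule insert.IH[OF 1 2 3])
    have c: "cmonom (f \<mu>) \<mu> \<in> T" using insert.prems(1) by (intro insert.prems(3)) auto
    have f: "f = ?g \<oplus>\<^bsub>poly_alg R I\<^esub> cmonom (f \<mu>) \<mu>"
      using coeff_closed[OF insert.prems(2)] by (simp add: poly_alg_simps cmonom_def fun_eq_iff)
    show ?case by (subst f) (rule additive_subgroup.a_closed[OF T.additive_subgroup_axioms g c])
  qed
  from this[OF _ refl assms(2,3)] assms(2) show ?thesis by (simp add: poly_alg_carrier)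
qed

text \<open>Each nonzero term on the right has an exponent \<open>s + \<delta>\<close> with
  \<open>s\<close> in \<open>S\<close>, so it is a multiple of the generator \<open>X^s\<close>.
  Generators are thereby traded for a condition on coefficients.\<close>

lemma genideal_monomials:
  assumes S: "S \<subseteq> exponents I"
  shows "genideal (poly_alg R I) (cmonom \<one> ` S) = coeff_ideal I (monomial_coeffs (upward_closure S))"
    (is "?L = ?R")
proof
  interpret P: cring "poly_alg R I" by (rule poly_alg_cring)
  have cl: "cmonom \<one> ` S \<subseteq> carrier (poly_alg R I)"
    using S by (auto intro!: cmonom_closed)
  have "cmonom \<one> ` S \<subseteq> ?R"
    using S cl upward_closure_superset[of S]
    by (auto simp: coeff_ideal_def monomial_coeffs_def cmonom_def)
  then show "?L \<subseteq> ?R" by (intro P.genideal_minimal monomial_coeffs_ideal)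
  have L: "ideal ?L (poly_alg R I)" by (rule P.genideal_ideal[OF cl])
  show "?R \<subseteq> ?L"
  proof
    fix f assume f: "f \<in> ?R"
    then have fc: "f \<in> carrier (poly_alg R I)" by (simp add: coeff_ideal_def)
    show "f \<in> ?L"
    proof (rule mem_ideal_of_monomials[OF L fc])
      fix \<mu> assume "f \<mu> \<noteq> \<zero>"
      then have "\<mu> \<in> upward_closure S" "\<mu> \<in> exponents I"
        using f fc by (auto simp: coeff_ideal_def monomial_coeffs_def poly_alg_carrier split: if_splits)
      then obtain s \<delta> where s: "s \<in> S" "\<mu> = s + \<delta>" "\<delta> \<in> exponents I" "s \<in> exponents I"
        by (auto simp: upward_closure_def exponents_add_iff)
      have "cmonom \<one> s \<in> ?L" using P.genideal_self[OF cl] s by blast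
      then have "cmonom (f \<mu>) \<delta> \<otimes>\<^bsub>poly_alg R I\<^esub> cmonom \<one> s \<in> ?L"
        using s fc by (intro ideal.I_l_closed[OF L] cmonom_closed) (auto simp: coeff_closed)
      then show "cmonom (f \<mu>) \<mu> \<in> ?L"
        using s fc by (simp add: cmonom_mult coeff_closed ab_semigroup_add_class.add.commute)
    qed
  qed
qed

section \<open>Products of variables as terms\<close>

text \<open>Membership of the partial sum in \<open>exponents I\<close> is carried along because
  \<open>cmonom_mult\<close> asks for it in the induction step.\<close>

lemma finprod_cmonom:
  assumes "finite K" "\<And>i. i \<in> K \<Longrightarrow> h i \<in> exponents I"
  shows "finprod (poly_alg R I) (\<lambda>i. cmonom \<one> (h i)) K = cmonom \<one> (\<Sum>i\<in>K. h i) \<and>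
    (\<Sum>i\<in>K. h i) \<in> exponents I"
  using assms
proof (induction K rule: finite_induct)
  case empty
  interpret P: cring "poly_alg R I" by (rule poly_alg_cring)
  show ?case by (simp add: one_poly exponents_def)
next
  case (insert i K)
  interpret P: cring "poly_alg R I" by (rule poly_alg_cring)
  have "finprod (poly_alg R I) (\<lambda>i. cmonom \<one> (h i)) (insert i K)
      = cmonom \<one> (h i) \<otimes>\<^bsub>poly_alg R I\<^esub> finprod (poly_alg R I) (\<lambda>i. cmonom \<one> (h i)) K"
    using insert by (intro P.finprod_insert) (auto intro!: cmonom_closed)
  with insert show ?case by (simp add: cmonom_mult exponents_add_iff)
qed

lemma var_eq_cmonom: "var R i = cmonom \<one> (Poly_Mapping.single i 1)"
  by (simp add: var_def cmonom_def)

lemma single_exponent: "i \<in> I \<Longrightarrow> Poly_Mapping.single i n \<in> exponents I"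
  by (auto simp: exponents_def split: if_splits)

lemma var_pow:
  assumes "i \<in> I"
  shows "var R i [^]\<^bsub>poly_alg R I\<^esub> n = cmonom \<one> (Poly_Mapping.single i n)"
proof -
  interpret P: cring "poly_alg R I" by (rule poly_alg_cring)
  show ?thesis
  proof (induction n)
    case 0
    show ?case by (simp add: one_poly)
  next
    case (Suc n)
    have "Poly_Mapping.single i n + Poly_Mapping.single i 1 = Poly_Mapping.single i (Suc n)"
      by (simp flip: single_add)
    with Suc assms show ?case
      by (simp add: var_eq_cmonom cmonom_mult[OF _ _ single_exponent])
  qed
qed

lemma monomial_eq_cmonom:
  assumes "\<mu> \<in> exponents I"
  shows "monomial R I \<mu> = cmonom \<one> \<mu>"
proof -
  interpret P: cring "poly_alg R I" by (rule poly_alg_cring)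
  have "i \<in> I" if "i \<in> Poly_Mapping.keys \<mu>" for i using assms that by (auto simp: exponents_def)
  then have "monomial R I \<mu> = finprod (poly_alg R I)
      (\<lambda>i. cmonom \<one> (Poly_Mapping.single i (Poly_Mapping.lookup \<mu> i))) (Poly_Mapping.keys \<mu>)"
    unfolding monomial_def
    by (intro P.finprod_cong') (auto simp: var_pow intro!: cmonom_closed single_exponent)
  then show ?thesis
    using finprod_cmonom[of "Poly_Mapping.keys \<mu>" "\<lambda>i. Poly_Mapping.single i (Poly_Mapping.lookup \<mu> i)" I]
      \<open>\<And>i. i \<in> _ \<Longrightarrow> i \<in> I\<close>
    by (simp add: single_exponent sum_single_lookup)
qed

lemma finprod_var:
  fixes I :: "'i set"
  assumes "\<mu> \<in> exponents I"
  shows "finprod (poly_alg R I) (var R) {i \<in> I. Poly_Mapping.lookup \<mu> i > 0}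
    = cmonom \<one> (support_exponent \<mu>)"
proof -
  have "{i \<in> I. Poly_Mapping.lookup \<mu> i > 0} = Poly_Mapping.keys \<mu>"
    using assms by (auto simp: exponents_def in_keys_iff)
  moreover have "var R = (\<lambda>i :: 'i. cmonom \<one> (Poly_Mapping.single i 1))"
    by (rule ext) (rule var_eq_cmonom)
  moreover have "\<And>i. i \<in> Poly_Mapping.keys \<mu> \<Longrightarrow> Poly_Mapping.single i 1 \<in> exponents I"
    using assms by (auto simp: exponents_def)
  ultimately show ?thesis
    using finprod_cmonom[of "Poly_Mapping.keys \<mu>" "\<lambda>i. Poly_Mapping.single i 1" I]
    by (simp add: support_exponent_def)
qed

lemma monomial_image: "S \<subseteq> exponents I \<Longrightarrow> monomial R I ` S = cmonom \<one> ` S"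
  by (intro image_cong refl monomial_eq_cmonom) blast

text \<open>The coefficient of \<open>X^e\<close> at \<open>e\<close> is 1. As 1 is not 0, the
  coefficient condition for \<open>S\<close> can hold there only if some member of \<open>S\<close>
  divides \<open>e\<close>.\<close>

lemma genideal_monomials_subset:
  assumes "\<one> \<noteq> \<zero>" "E \<subseteq> exponents I" "S \<subseteq> exponents I"
    and "genideal (poly_alg R I) (cmonom \<one> ` E) = genideal (poly_alg R I) (cmonom \<one> ` S)"
  shows "E \<subseteq> upward_closure S"
proof
  interpret P: cring "poly_alg R I" by (rule poly_alg_cring)
  fix e assume "e \<in> E"
  moreover have "cmonom \<one> ` E \<subseteq> genideal (poly_alg R I) (cmonom \<one> ` E)"
    using assms(2) by (intro P.genideal_self) (auto intro!: cmonom_closed)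
  ultimately have "cmonom \<one> e \<in> coeff_ideal I (monomial_coeffs (upward_closure S))"
    using assms(4) genideal_monomials[OF assms(3)] by auto
  then have "cmonom \<one> e e \<in> monomial_coeffs (upward_closure S) e" by (simp add: coeff_ideal_def)
  with assms(1) show "e \<in> upward_closure S"
    by (auto simp: monomial_coeffs_def cmonom_def split: if_splits)
qed

section \<open>The minimal generating set of a monomial ideal\<close>

text \<open>Justifies the definite description in \<open>min_exponents\<close>. Over a nonzero ring
  the divisibility-minimal exponents of any generating set do the job, since every other generating
  set of monomials must contain them.\<close>

lemma min_exponents_exists_unique:
  fixes I :: "'i set"
  assumes a: "monomial_ideal R I \<aa>"
  shows "\<exists>!E. E \<subseteq> exponents I \<and> minimal_generating_set (poly_alg R I) \<aa> (monomial R I ` E)"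
proof -
  interpret P: cring "poly_alg R I" by (rule poly_alg_cring)
  obtain S where S: "S \<subseteq> exponents I" and aS: "\<aa> = genideal (poly_alg R I) (cmonom \<one> ` S)"
    using a monomial_image unfolding monomial_ideal_def by metis
  have car: "cmonom \<one> ` E \<subseteq> carrier (poly_alg R I)" if "E \<subseteq> exponents I" for E
    using that by (auto intro!: cmonom_closed)
  show ?thesis
  proof (cases "\<one> = \<zero>")
    case True
    \<comment> \<open>Over the zero ring all monomials coincide. The only ideal is generated by the
      empty set, and minimality excludes every nonempty candidate.\<close>
    then have "carrier R = {\<zero>}" by (rule one_zeroD)
    then have "carrier (poly_alg R I) \<subseteq> {\<zero>\<^bsub>poly_alg R I\<^esub>}"
      by (auto simp: poly_alg_carrier poly_alg_simps)
    then have eq: "T = {\<zero>\<^bsub>poly_alg R I\<^esub>}" if "ideal T (poly_alg R I)" for T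
      using that ideal.Icarr[OF that] ideal.zero_mem[OF that] by blast
    have gen: "genideal (poly_alg R I) {} = \<aa>"
      unfolding aS using eq[OF P.genideal_ideal] car[OF S] by blast
    show ?thesis
    proof (rule ex1I[of _ "{}"])
      show "{} \<subseteq> exponents I \<and> minimal_generating_set (poly_alg R I) \<aa> (monomial R I ` {})"
        using gen by (simp add: minimal_generating_set_def)
      fix E assume "E \<subseteq> exponents I \<and> minimal_generating_set (poly_alg R I) \<aa> (monomial R I ` E)"
      then show "E = {}" using gen unfolding minimal_generating_set_def by blast
    qed
  next
    case False
    let ?M = "minimal_exponents S"
    have M: "?M \<subseteq> exponents I" using S by (auto simp: minimal_exponents_def)
    have "upward_closure ?M = upward_closure S"
    proof (intro equalityI upward_closure_subset)
      show "?M \<subseteq> upward_closure S" using upward_closure_superset by (auto simp: minimal_exponents_def)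
    qed (rule subset_upward_closure_minimal)
    then have genM: "genideal (poly_alg R I) (cmonom \<one> ` ?M) = \<aa>"
      by (simp add: aS genideal_monomials M S)
    have sub: "?M \<subseteq> E" if "E \<subseteq> exponents I" "genideal (poly_alg R I) (cmonom \<one> ` E) = \<aa>" for E
      using that genideal_monomials_subset[OF False that(1) S]
        genideal_monomials_subset[OF False S that(1)] aS
      by (intro minimal_exponents_subset) simp_all
    show ?thesis
    proof (rule ex1I[of _ ?M])
      have "genideal (poly_alg R I) T \<noteq> \<aa>" if T: "T \<subset> cmonom \<one> ` ?M" for T
      proof
        assume "genideal (poly_alg R I) T = \<aa>"
        \<comment> \<open>A smaller generating set is again a set of monomials, so
          \<open>sub\<close> forces it to contain all of \<open>?M\<close>.\<close>
        moreover obtain E where E: "T = cmonom \<one> ` E" "E \<subseteq> ?M"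
          using T by (meson psubset_imp_subset subset_imageE)
        ultimately have "?M \<subseteq> E" using M by (intro sub) auto
        with E T show False by blast
      qed
      then show "?M \<subseteq> exponents I \<and> minimal_generating_set (poly_alg R I) \<aa> (monomial R I ` ?M)"
        using M genM car[OF M] by (simp add: minimal_generating_set_def monomial_image)
      fix E assume E: "E \<subseteq> exponents I \<and> minimal_generating_set (poly_alg R I) \<aa> (monomial R I ` E)"
      then have gen: "genideal (poly_alg R I) (cmonom \<one> ` E) = \<aa>"
        and min: "\<And>T. T \<subset> cmonom \<one> ` E \<Longrightarrow> genideal (poly_alg R I) T \<noteq> \<aa>"
        by (auto simp: minimal_generating_set_def monomial_image)
      \<comment> \<open>Minimality speaks of sets of monomials; injectivity, which rests on 1 being
        different from 0, carries it back to sets of exponents.\<close>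
      have "inj (cmonom \<one> :: ('i \<Rightarrow>\<^sub>0 nat) \<Rightarrow> _)"
        using False by (auto simp: inj_def cmonom_def fun_eq_iff split: if_splits)
      then have "cmonom \<one> ` ?M = cmonom \<one> ` E \<Longrightarrow> ?M = E" by (simp add: inj_image_eq_iff)
      moreover have "?M \<subseteq> E" using E gen by (intro sub) auto
      moreover have "\<not> cmonom \<one> ` ?M \<subset> cmonom \<one> ` E" using min genM by metis
      ultimately show "E = ?M" by (metis image_mono psubsetI)
    qed
  qed
qed

text \<open>The interface through which \<open>E(\<aa>)\<close> is used from here on: both ideals
  become coefficient conditions for explicit upward closed sets.\<close>

lemma min_exponents_generate:
  assumes "monomial_ideal R I \<aa>"
  shows "min_exponents R I \<aa> \<subseteq> exponents I"
    and "\<aa> = coeff_ideal I (monomial_coeffs (upward_closure (min_exponents R I \<aa>)))"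
    and "squarefree_part_ideal R I \<aa> =
      coeff_ideal I (monomial_coeffs (upward_closure (support_exponent ` min_exponents R I \<aa>)))"
proof -
  let ?E = "min_exponents R I \<aa>"
  have E: "?E \<subseteq> exponents I \<and> minimal_generating_set (poly_alg R I) \<aa> (monomial R I ` ?E)"
    unfolding min_exponents_def by (rule theI'[OF min_exponents_exists_unique[OF assms]])
  then show "?E \<subseteq> exponents I" by blast
  with E show "\<aa> = coeff_ideal I (monomial_coeffs (upward_closure ?E))"
    by (auto simp: minimal_generating_set_def monomial_image genideal_monomials)
  have "(\<lambda>\<mu>. finprod (poly_alg R I) (var R) {i \<in> I. Poly_Mapping.lookup \<mu> i > 0}) ` ?E
      = cmonom \<one> ` support_exponent ` ?E"
    unfolding image_image using E by (intro image_cong refl finprod_var) blast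
  moreover have "support_exponent ` ?E \<subseteq> exponents I"
    using E support_exponent_exponents by blast
  ultimately show "squarefree_part_ideal R I \<aa> =
      coeff_ideal I (monomial_coeffs (upward_closure (support_exponent ` ?E)))"
    unfolding squarefree_part_ideal_def by (simp add: genideal_monomials)
qed

end

section \<open>Powers and radicals of ideals\<close>

lemma ideal_pow_0: "T [^]\<^bsub>ideals_set R\<^esub> (0::nat) = carrier R"
  by (simp add: nat_pow_def ideals_set_def)

lemma ideal_pow_Suc: "T [^]\<^bsub>ideals_set R\<^esub> Suc n = ideal_prod R (T [^]\<^bsub>ideals_set R\<^esub> n) T"
  by (simp add: nat_pow_def ideals_set_def)

lemma ideal_prod_mono:
  assumes "S \<subseteq> S'" "T \<subseteq> T'"
  shows "ideal_prod R S T \<subseteq> ideal_prod R S' T'"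
proof
  fix x assume "x \<in> ideal_prod R S T"
  then show "x \<in> ideal_prod R S' T'"
    by induction (use assms in \<open>auto intro: ideal_prod.intros\<close>)
qed

lemma ideal_pow_mono: "S \<subseteq> T \<Longrightarrow> S [^]\<^bsub>ideals_set R\<^esub> (n::nat) \<subseteq> T [^]\<^bsub>ideals_set R\<^esub> n"
  by (induction n) (simp_all add: ideal_pow_0 ideal_pow_Suc ideal_prod_mono del: Group.nat_pow_0 Group.nat_pow_Suc)

lemma (in ideal) mem_of_add_mem:
  assumes "a \<in> carrier R" "a \<oplus> b \<in> I" "b \<in> I"
  shows "a \<in> I"
proof -
  have "(a \<oplus> b) \<oplus> (\<ominus> b) \<in> I"
    using assms additive_subgroup.a_closed[OF additive_subgroup_axioms]
      additive_subgroup.a_inv_closed[OF additive_subgroup_axioms] by blast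
  moreover have "(a \<oplus> b) \<oplus> (\<ominus> b) = a"
    using assms Icarr by (simp add: a_assoc r_neg)
  ultimately show ?thesis by simp
qed

lemma (in ideal) ideal_prod_subset:
  assumes "\<And>i j. i \<in> S \<Longrightarrow> j \<in> T \<Longrightarrow> i \<otimes> j \<in> I"
  shows "ideal_prod R S T \<subseteq> I"
proof
  fix x assume "x \<in> ideal_prod R S T"
  then show "x \<in> I"
  proof (induction rule: ideal_prod.induct)
    case (prod i j)
    then show ?case by (rule assms)
  next
    case (sum s1 s2)
    show ?case by (rule additive_subgroup.a_closed[OF additive_subgroup_axioms sum.IH])
  qed
qed

lemma set_add_memI: "a \<in> S \<Longrightarrow> b \<in> T \<Longrightarrow> a \<oplus>\<^bsub>R\<^esub> b \<in> S <+>\<^bsub>R\<^esub> T"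
  unfolding set_add_def' by blast

context cring
begin

lemma ideal_pow_ideal: "ideal T R \<Longrightarrow> ideal (T [^]\<^bsub>ideals_set R\<^esub> (n::nat)) R"
  by (induction n) (simp_all add: ideal_pow_0 ideal_pow_Suc oneideal ideal_prod_is_ideal del: Group.nat_pow_0 Group.nat_pow_Suc)

lemma set_add_mono:
  assumes "S \<subseteq> S'" "T \<subseteq> T'"
  shows "S <+>\<^bsub>R\<^esub> T \<subseteq> S' <+>\<^bsub>R\<^esub> T'"
  using assms by (auto simp: set_add_def')

lemma ideal_add_self: "ideal S R \<Longrightarrow> S <+>\<^bsub>R\<^esub> S \<subseteq> S"
  by (auto simp: set_add_def' ideal_def additive_subgroup.a_closed)

lemma ideal_add_left: "ideal S R \<Longrightarrow> ideal T R \<Longrightarrow> S \<subseteq> S <+>\<^bsub>R\<^esub> T"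
proof
  fix x assume "ideal S R" "ideal T R" "x \<in> S"
  then have "x \<oplus> \<zero> \<in> S <+>\<^bsub>R\<^esub> T"
    using set_add_memI[where R = R] ideal.zero_mem by blast
  moreover have "x \<oplus> \<zero> = x" using \<open>ideal S R\<close> \<open>x \<in> S\<close> by (simp add: ideal.Icarr)
  ultimately show "x \<in> S <+>\<^bsub>R\<^esub> T" by simp
qed

lemma ideal_add_right: "ideal S R \<Longrightarrow> ideal T R \<Longrightarrow> T \<subseteq> S <+>\<^bsub>R\<^esub> T"
  using ideal_add_left[of T S] by (simp add: set_add_comm ideal.Icarr subsetI)

text \<open>Pigeonhole: of \<open>m + n\<close> factors from L or K, at least \<open>m\<close> come
  from L or at least \<open>n\<close> from K. In the induction a last factor from L lowers
  \<open>m\<close> and one from K lowers \<open>n\<close>; if \<open>m\<close> or \<open>n\<close>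
  is 0, the right side is the whole ring.\<close>

lemma ideal_sum_pow:
  assumes L: "ideal L R" and K: "ideal K R"
  shows "(L <+>\<^bsub>R\<^esub> K) [^]\<^bsub>ideals_set R\<^esub> (m + n :: nat)
    \<subseteq> L [^]\<^bsub>ideals_set R\<^esub> m <+>\<^bsub>R\<^esub> K [^]\<^bsub>ideals_set R\<^esub> n"
proof (induction "m + n" arbitrary: m n)
  case 0
  then show ?case
    using ideal_add_left[OF oneideal oneideal] by (simp add: ideal_pow_0 del: Group.nat_pow_0)
next
  case (Suc k)
  let ?S = "L <+>\<^bsub>R\<^esub> K"
  note LK = add_ideals[OF L K]
  have car: "T \<subseteq> carrier R" if "ideal T R" for T using that by (auto simp: ideal.Icarr)
  consider "m = 0" | "n = 0" | m' n' where "m = Suc m'" "n = Suc n'"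
    by (cases m; cases n) auto
  then show ?case
  proof cases
    case 1
    then show ?thesis
      using car[OF ideal_pow_ideal[OF LK]] ideal_add_left[OF oneideal ideal_pow_ideal[OF K]]
      by (auto simp: ideal_pow_0 simp del: Group.nat_pow_0)
  next
    case 2
    then show ?thesis
      using car[OF ideal_pow_ideal[OF LK]] ideal_add_right[OF ideal_pow_ideal[OF L] oneideal]
      by (auto simp: ideal_pow_0 simp del: Group.nat_pow_0)
  next
    case 3
    let ?L = "\<lambda>i::nat. L [^]\<^bsub>ideals_set R\<^esub> i" and ?K = "\<lambda>i::nat. K [^]\<^bsub>ideals_set R\<^esub> i"
    note pL = ideal_pow_ideal[OF L] and pK = ideal_pow_ideal[OF K]
    have IH1: "?S [^]\<^bsub>ideals_set R\<^esub> k \<subseteq> ?L m' <+>\<^bsub>R\<^esub> ?K n"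
      using Suc.hyps(1)[of m' n] Suc.hyps(2) 3 by simp
    have IH2: "?S [^]\<^bsub>ideals_set R\<^esub> k \<subseteq> ?L m <+>\<^bsub>R\<^esub> ?K n'"
      using Suc.hyps(1)[of m n'] Suc.hyps(2) 3 by simp
    \<comment> \<open>The extra factor from L completes the power of L, while the power of K absorbs
      it, being an ideal.\<close>
    have a: "ideal_prod R (?S [^]\<^bsub>ideals_set R\<^esub> k) L \<subseteq> ?L m <+>\<^bsub>R\<^esub> ?K n"
    proof -
      have "ideal_prod R (?S [^]\<^bsub>ideals_set R\<^esub> k) L \<subseteq> ideal_prod R (?L m' <+>\<^bsub>R\<^esub> ?K n) L"
        by (rule ideal_prod_mono[OF IH1 subset_refl])
      also have "\<dots> = ideal_prod R (?L m') L <+>\<^bsub>R\<^esub> ideal_prod R (?K n) L"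
        by (rule ideal_prod_distr(2)[OF L pL pK])
      also have "ideal_prod R (?L m') L = ?L m"
        using 3 by (simp only: ideal_pow_Suc)
      also have "?L m <+>\<^bsub>R\<^esub> ideal_prod R (?K n) L \<subseteq> ?L m <+>\<^bsub>R\<^esub> ?K n"
        using ideal_prod_inter[OF pK L] by (intro set_add_mono) auto
      finally show ?thesis .
    qed
    have b: "ideal_prod R (?S [^]\<^bsub>ideals_set R\<^esub> k) K \<subseteq> ?L m <+>\<^bsub>R\<^esub> ?K n"
    proof -
      have "ideal_prod R (?S [^]\<^bsub>ideals_set R\<^esub> k) K \<subseteq> ideal_prod R (?L m <+>\<^bsub>R\<^esub> ?K n') K"
        by (rule ideal_prod_mono[OF IH2 subset_refl])
      also have "\<dots> = ideal_prod R (?L m) K <+>\<^bsub>R\<^esub> ideal_prod R (?K n') K"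
        by (rule ideal_prod_distr(2)[OF K pL pK])
      also have "ideal_prod R (?K n') K = ?K n"
        using 3 by (simp only: ideal_pow_Suc)
      also have "ideal_prod R (?L m) K <+>\<^bsub>R\<^esub> ?K n \<subseteq> ?L m <+>\<^bsub>R\<^esub> ?K n"
        using ideal_prod_inter[OF pL K] by (intro set_add_mono) auto
      finally show ?thesis .
    qed
    have "?S [^]\<^bsub>ideals_set R\<^esub> (m + n) = ideal_prod R (?S [^]\<^bsub>ideals_set R\<^esub> k) ?S"
      using Suc.hyps(2) by (simp flip: ideal_pow_Suc del: Group.nat_pow_Suc)
    also have "\<dots> = ideal_prod R (?S [^]\<^bsub>ideals_set R\<^esub> k) L <+>\<^bsub>R\<^esub> ideal_prod R (?S [^]\<^bsub>ideals_set R\<^esub> k) K"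
      by (rule ideal_prod_r_distr[OF ideal_pow_ideal[OF LK] L K])
    also have "\<dots> \<subseteq> (?L m <+>\<^bsub>R\<^esub> ?K n) <+>\<^bsub>R\<^esub> (?L m <+>\<^bsub>R\<^esub> ?K n)" by (rule set_add_mono[OF a b])
    also have "\<dots> \<subseteq> ?L m <+>\<^bsub>R\<^esub> ?K n" by (rule ideal_add_self[OF add_ideals[OF pL pK]])
    finally show ?thesis .
  qed
qed

section \<open>The radical of an ideal\<close>

text \<open>Stands in for the binomial theorem. The free exponents \<open>a\<close> and
  \<open>b\<close> let the induction expand one factor \<open>x \<oplus> y\<close> at a time with
  \<open>a + b + k\<close> fixed; at \<open>k = 0\<close>, one of \<open>x\<close> and
  \<open>y\<close> has reached its power in \<open>T\<close>.\<close>

lemma pow_add_mem_ideal: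
  assumes T: "ideal T R" and x: "x \<in> carrier R" "x [^] (m::nat) \<in> T"
    and y: "y \<in> carrier R" "y [^] (n::nat) \<in> T"
  shows "m + n \<le> a + b + k \<Longrightarrow> x [^] a \<otimes> y [^] b \<otimes> (x \<oplus> y) [^] (k::nat) \<in> T"
proof (induction k arbitrary: a b)
  case 0
  then consider "m \<le> a" | "n \<le> b" by linarith
  then show ?case
  proof cases
    case 1
    then have "x [^] a = x [^] (a - m) \<otimes> x [^] m" using x by (simp add: nat_pow_mult)
    then have "x [^] a \<in> T" using x by (simp add: ideal.I_l_closed[OF T])
    then show ?thesis using x y by (simp add: ideal.I_r_closed[OF T])
  next
    case 2
    then have "y [^] b = y [^] (b - n) \<otimes> y [^] n" using y by (simp add: nat_pow_mult)
    then have "y [^] b \<in> T" using y by (simp add: ideal.I_l_closed[OF T])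
    then show ?thesis using x y by (simp add: ideal.I_l_closed[OF T])
  qed
next
  case (Suc k)
  let ?z = "(x \<oplus> y) [^] k"
  have "x [^] a \<otimes> y [^] b \<otimes> (x \<oplus> y) [^] Suc k
      = x [^] Suc a \<otimes> y [^] b \<otimes> ?z \<oplus> x [^] a \<otimes> y [^] Suc b \<otimes> ?z"
    using x(1) y(1) by (simp add: l_distr r_distr m_ac)
  moreover have "\<dots> \<in> T"
    using Suc.prems by (intro additive_subgroup.a_closed[OF ideal.axioms(1)[OF T]] Suc.IH) simp_all
  ultimately show ?case by simp
qed

lemma ideal_radical_ideal:
  assumes T: "ideal T R"
  shows "ideal (ideal_radical R T) R"
proof (rule idealI)
  have l: "r \<otimes> x \<in> ideal_radical R T" if x: "x \<in> ideal_radical R T" and r: "r \<in> carrier R" for r x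
  proof -
    obtain n :: nat where "x \<in> carrier R" "x [^] n \<in> T" using x by (auto simp: ideal_radical_def)
    moreover from this r have "(r \<otimes> x) [^] n \<in> T"
      by (simp add: nat_pow_distrib ideal.I_l_closed[OF T])
    ultimately show ?thesis using r by (auto simp: ideal_radical_def)
  qed
  show "subgroup (ideal_radical R T) (add_monoid R)"
  proof (rule add.subgroupI)
    have "\<zero> [^] (1::nat) \<in> T" by (simp add: ideal.zero_mem[OF T])
    then show "ideal_radical R T \<noteq> {}" unfolding ideal_radical_def by blast
    show "\<ominus> x \<in> ideal_radical R T" if "x \<in> ideal_radical R T" for x
    proof -
      have "\<ominus> x = (\<ominus> \<one>) \<otimes> x" using that by (simp add: ideal_radical_def l_minus)
      with l[OF that, of "\<ominus> \<one>"] show ?thesis by simp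
    qed
    show "x \<oplus> y \<in> ideal_radical R T" if xy: "x \<in> ideal_radical R T" "y \<in> ideal_radical R T" for x y
    proof -
      obtain m n :: nat where "x [^] m \<in> T" "y [^] n \<in> T" and c: "x \<in> carrier R" "y \<in> carrier R"
        using xy by (auto simp: ideal_radical_def)
      then have "x [^] (0::nat) \<otimes> y [^] (0::nat) \<otimes> (x \<oplus> y) [^] (m + n) \<in> T"
        by (intro pow_add_mem_ideal[OF T]) auto
      with c show ?thesis by (auto simp: ideal_radical_def)
    qed
  qed (auto simp: ideal_radical_def)
  fix r x assume x: "x \<in> ideal_radical R T" and r: "r \<in> carrier R"
  then show "r \<otimes> x \<in> ideal_radical R T" by (rule l)
  with x r show "x \<otimes> r \<in> ideal_radical R T" by (simp add: ideal_radical_def m_comm)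
qed (rule ring_axioms)

lemma nilradical_ideal: "ideal (nilradical R) R"
  unfolding nilradical_def by (rule ideal_radical_ideal[OF zeroideal])

lemma square_mem_nilradical:
  assumes "c \<in> carrier R" "c \<otimes> c \<in> nilradical R"
  shows "c \<in> nilradical R"
proof -
  obtain n :: nat where "(c \<otimes> c) [^] n = \<zero>" using assms by (auto simp: nilradical_def ideal_radical_def)
  then have "c [^] (n + n) = \<zero>" using assms(1) by (simp add: nat_pow_distrib nat_pow_mult)
  with assms(1) show ?thesis by (auto simp: nilradical_def ideal_radical_def)
qed

text \<open>If a power of \<open>x\<close> lies in \<open>J\<close>, so does the square of a power
  with about half the exponent; extracting the root repeatedly leads down to
  \<open>x\<close>.\<close>

lemma ideal_radical_subset_if_square_closed:
  assumes J: "ideal J R" and sq: "\<And>x. x \<in> carrier R \<Longrightarrow> x \<otimes> x \<in> J \<Longrightarrow> x \<in> J" and "T \<subseteq> J"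
  shows "ideal_radical R T \<subseteq> J"
proof
  fix x assume "x \<in> ideal_radical R T"
  then obtain n :: nat where x: "x \<in> carrier R" "x [^] n \<in> J"
    using \<open>T \<subseteq> J\<close> by (auto simp: ideal_radical_def)
  then show "x \<in> J"
  proof (induction n rule: less_induct)
    case (less n)
    consider "n = 0" | "n = 1" | "n \<ge> 2" by linarith
    then show ?case
    proof cases
      case 1
      then show ?thesis using less.prems ideal.I_l_closed[OF J, of \<one> x] by simp
    next
      case 2
      then show ?thesis using less.prems by simp
    next
      case 3
      \<comment> \<open>Half of \<open>n\<close> rounded up: \<open>x^(2m)\<close> is a multiple of
        \<open>x^n\<close>, and \<open>n \<ge> 2\<close> makes \<open>m\<close> smaller than
        \<open>n\<close>.\<close>
      define m where "m = (n + 1) div 2"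
      have m: "n \<le> m + m" "m < n" using 3 unfolding m_def by auto
      have "x [^] (m + m - n) \<otimes> x [^] n \<in> J"
        using less.prems by (intro ideal.I_l_closed[OF J]) auto
      moreover have "x [^] m \<otimes> x [^] m = x [^] (m + m - n) \<otimes> x [^] n"
        using less.prems(1) m(1) by (simp add: nat_pow_mult)
      ultimately have "x [^] m \<in> J" using less.prems(1) sq[of "x [^] m"] by simp
      then show ?thesis by (rule less.IH[OF m(2) less.prems(1)])
    qed
  qed
qed

end

section \<open>Radicals of monomial ideals\<close>

text \<open>With \<open>a = m + t\<close> and \<open>b = m - t\<close> the sum of squares is
  \<open>2 m^2 + 2 t^2\<close>. The computation takes place in the integers because \<open>t\<close>
  may be negative.\<close>

lemma sum_squares_ge_midpoint:
  fixes a b m :: nat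
  assumes "a + b = m + m"
  shows "m\<^sup>2 + m\<^sup>2 \<le> a\<^sup>2 + b\<^sup>2" and "a \<noteq> m \<Longrightarrow> m\<^sup>2 + m\<^sup>2 < a\<^sup>2 + b\<^sup>2"
proof -
  have "int b = int m - (int a - int m)" using assms by linarith
  then have "(int a)\<^sup>2 + (int b)\<^sup>2 = (int m)\<^sup>2 + (int m)\<^sup>2 + 2 * (int a - int m)\<^sup>2"
    by (simp only:) (simp add: power2_eq_square algebra_simps)
  then have *: "int (a\<^sup>2 + b\<^sup>2) = int (m\<^sup>2 + m\<^sup>2) + 2 * (int a - int m)\<^sup>2" by simp
  have "0 \<le> (int a - int m)\<^sup>2" by simp
  with * show "m\<^sup>2 + m\<^sup>2 \<le> a\<^sup>2 + b\<^sup>2" by linarith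
  assume "a \<noteq> m"
  then have "0 < (int a - int m)\<^sup>2" by simp
  with * show "m\<^sup>2 + m\<^sup>2 < a\<^sup>2 + b\<^sup>2" by linarith
qed

definition square_norm :: "('i \<Rightarrow>\<^sub>0 nat) \<Rightarrow> nat" where
  "square_norm \<mu> = (\<Sum>i\<in>Poly_Mapping.keys \<mu>. (Poly_Mapping.lookup \<mu> i)\<^sup>2)"

lemma square_norm_superset:
  assumes "finite K" "Poly_Mapping.keys \<mu> \<subseteq> K"
  shows "square_norm \<mu> = (\<Sum>i\<in>K. (Poly_Mapping.lookup \<mu> i)\<^sup>2)"
  unfolding square_norm_def using assms by (intro sum.mono_neutral_left) (auto simp: in_keys_iff)

text \<open>The midpoint of two distinct points of a Euclidean ball lies strictly inside it, so a
  midpoint on the boundary forces the points to agree.\<close>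

lemma square_norm_midpoint:
  fixes \<mu> :: "'i \<Rightarrow>\<^sub>0 nat"
  assumes eq: "\<alpha> + \<beta> = \<mu> + \<mu>" and "square_norm \<alpha> \<le> square_norm \<mu>" "square_norm \<beta> \<le> square_norm \<mu>"
  shows "\<alpha> = \<mu>"
proof (rule ccontr)
  assume "\<alpha> \<noteq> \<mu>"
  let ?K = "Poly_Mapping.keys \<mu>"
  let ?l = "Poly_Mapping.lookup :: ('i \<Rightarrow>\<^sub>0 nat) \<Rightarrow> _"
  have lk: "?l \<alpha> i + ?l \<beta> i = ?l \<mu> i + ?l \<mu> i" for i
    using arg_cong[OF eq, of "\<lambda>\<nu>. ?l \<nu> i"] by (simp add: Poly_Mapping.lookup_add)
  \<comment> \<open>Entries are natural numbers and cannot cancel, so both summands live on the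
    support of \<mu> and all three norms can be summed over \<open>?K\<close>.\<close>
  have keys: "Poly_Mapping.keys \<alpha> \<union> Poly_Mapping.keys \<beta> = ?K"
    using arg_cong[OF eq, of Poly_Mapping.keys] by (simp add: keys_add_nat)
  have "\<exists>i. ?l \<alpha> i \<noteq> ?l \<mu> i"
  proof (rule ccontr)
    assume "\<nexists>i. ?l \<alpha> i \<noteq> ?l \<mu> i"
    then have "\<alpha> = \<mu>" by (intro poly_mapping_eqI) simp
    with \<open>\<alpha> \<noteq> \<mu>\<close> show False by simp
  qed
  then obtain i where i: "?l \<alpha> i \<noteq> ?l \<mu> i" by blast
  with lk[of i] have iK: "i \<in> ?K" by (simp add: in_keys_iff)
  have "(\<Sum>i\<in>?K. (?l \<mu> i)\<^sup>2 + (?l \<mu> i)\<^sup>2) < (\<Sum>i\<in>?K. (?l \<alpha> i)\<^sup>2 + (?l \<beta> i)\<^sup>2)"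
  proof (rule sum_strict_mono_ex1)
    show "\<forall>i\<in>?K. (?l \<mu> i)\<^sup>2 + (?l \<mu> i)\<^sup>2 \<le> (?l \<alpha> i)\<^sup>2 + (?l \<beta> i)\<^sup>2"
      by (intro ballI sum_squares_ge_midpoint(1) lk)
    show "\<exists>i\<in>?K. (?l \<mu> i)\<^sup>2 + (?l \<mu> i)\<^sup>2 < (?l \<alpha> i)\<^sup>2 + (?l \<beta> i)\<^sup>2"
      by (rule bexI[of _ i], rule sum_squares_ge_midpoint(2)[OF lk i], rule iK)
  qed simp
  moreover have "square_norm \<alpha> = (\<Sum>i\<in>?K. (?l \<alpha> i)\<^sup>2)" "square_norm \<beta> = (\<Sum>i\<in>?K. (?l \<beta> i)\<^sup>2)"
      "square_norm \<mu> = (\<Sum>i\<in>?K. (?l \<mu> i)\<^sup>2)"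
    using keys by (intro square_norm_superset[OF finite_keys]; blast)+
  ultimately have "square_norm \<mu> + square_norm \<mu> < square_norm \<alpha> + square_norm \<beta>"
    by (simp only: sum.distrib)
  with assms(2,3) show False by linarith
qed

context cring
begin

lemma square_mem_coeff_ideal:
  fixes f :: "('i, 'a) mpoly"
  assumes U: "\<And>\<mu> \<delta>. \<mu> \<in> U \<Longrightarrow> \<mu> + \<delta> \<in> U" and half: "\<And>\<mu>. \<mu> + \<mu> \<in> U \<Longrightarrow> \<mu> \<in> U"
    and f: "f \<in> carrier (poly_alg R I)"
    and ff: "f \<otimes>\<^bsub>poly_alg R I\<^esub> f \<in> coeff_ideal I (\<lambda>\<mu>. if \<mu> \<in> U then carrier R else nilradical R)"
  shows "f \<in> coeff_ideal I (\<lambda>\<mu>. if \<mu> \<in> U then carrier R else nilradical R)"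
proof (rule ccontr)
  assume not: "f \<notin> coeff_ideal I (\<lambda>\<mu>. if \<mu> \<in> U then carrier R else nilradical R)"
  interpret N: ideal "nilradical R" R by (rule nilradical_ideal)
  note cl = coeff_closed[OF f]
  \<comment> \<open>For \<open>\<mu>\<close> of maximal Euclidean norm among the bad exponents, \<open>(\<mu>, \<mu>)\<close> is the only pair of
    bad exponents with sum \<open>2 \<mu>\<close>, so \<open>f \<mu>\<close> squared is the coefficient of \<open>f\<close> squared at \<open>2 \<mu>\<close>,
    up to nilpotent terms.\<close>
  let ?F = "{\<mu>. f \<mu> \<notin> nilradical R \<and> \<mu> \<notin> U}"
  have "?F \<subseteq> {\<mu>. f \<mu> \<noteq> \<zero>}" using N.zero_mem by auto
  then have fin: "finite ?F" using f by (auto simp: poly_alg_carrier intro: finite_subset)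
  have "?F \<noteq> {}" using not f cl unfolding coeff_ideal_def by (auto split: if_splits)
  then have "Max (square_norm ` ?F) \<in> square_norm ` ?F" using fin by (intro Max_in) auto
  then obtain \<mu> where \<mu>: "\<mu> \<in> ?F" "Max (square_norm ` ?F) = square_norm \<mu>" by (rule imageE) simp
  have max: "square_norm \<nu> \<le> square_norm \<mu>" if "\<nu> \<in> ?F" for \<nu>
    using that fin Max_ge[of "square_norm ` ?F" "square_norm \<nu>"] \<mu>(2) by simp
  let ?T = "{(\<alpha>, \<beta>). \<alpha> + \<beta> = \<mu> + \<mu>}"
  let ?h = "\<lambda>(\<alpha>, \<beta>). f \<alpha> \<otimes> f \<beta>"
  \<comment> \<open>Closure under halving keeps \<open>\<mu> + \<mu>\<close> outside
    \<open>U\<close>. Hence the coefficient of the square there is nilpotent, and by upward closure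
    no summand of \<open>\<mu> + \<mu>\<close> lies in \<open>U\<close>.\<close>
  have notU: "\<mu> + \<mu> \<notin> U" using \<mu>(1) half by blast
  have "?h p \<in> nilradical R" if p: "p \<in> ?T - {(\<mu>, \<mu>)}" for p
  proof -
    obtain \<alpha> \<beta> where ab: "p = (\<alpha>, \<beta>)" "\<alpha> + \<beta> = \<mu> + \<mu>" "\<beta> + \<alpha> = \<mu> + \<mu>"
      using p by (auto simp: ab_semigroup_add_class.add.commute)
    then have "\<alpha> \<notin> U" "\<beta> \<notin> U" using U[of \<alpha> \<beta>] U[of \<beta> \<alpha>] notU by auto
    have "\<alpha> \<notin> ?F \<or> \<beta> \<notin> ?F"
    proof (rule ccontr)
      assume "\<not> (\<alpha> \<notin> ?F \<or> \<beta> \<notin> ?F)"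
      then have "\<alpha> = \<mu>" "\<beta> = \<mu>"
        using square_norm_midpoint[OF ab(2)] square_norm_midpoint[OF ab(3)] max by blast+
      with p ab(1) show False by simp
    qed
    with \<open>\<alpha> \<notin> U\<close> \<open>\<beta> \<notin> U\<close> have "f \<alpha> \<in> nilradical R \<or> f \<beta> \<in> nilradical R" by blast
    then show ?thesis using cl by (auto simp: ab(1) intro: N.I_l_closed N.I_r_closed)
  qed
  then have rest: "finsum R ?h (?T - {(\<mu>, \<mu>)}) \<in> nilradical R" by (rule N.finsum_mem)
  have "finsum R ?h (insert (\<mu>, \<mu>) (?T - {(\<mu>, \<mu>)})) = ?h (\<mu>, \<mu>) \<oplus> finsum R ?h (?T - {(\<mu>, \<mu>)})"
    using cl by (intro finsum_insert) (auto simp: finite_sum_pairs)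
  moreover have "insert (\<mu>, \<mu>) (?T - {(\<mu>, \<mu>)}) = ?T" by auto
  ultimately have eq: "(f \<otimes>\<^bsub>poly_alg R I\<^esub> f) (\<mu> + \<mu>) = f \<mu> \<otimes> f \<mu> \<oplus> finsum R ?h (?T - {(\<mu>, \<mu>)})"
    by (simp add: poly_alg_simps)
  have "(f \<otimes>\<^bsub>poly_alg R I\<^esub> f) (\<mu> + \<mu>) \<in> nilradical R"
  proof -
    have "(f \<otimes>\<^bsub>poly_alg R I\<^esub> f) (\<mu> + \<mu>) \<in> (if \<mu> + \<mu> \<in> U then carrier R else nilradical R)"
      using ff unfolding coeff_ideal_def by blast
    with notU show ?thesis by simp
  qed
  then have "f \<mu> \<otimes> f \<mu> \<in> nilradical R"
    unfolding eq by (rule N.mem_of_add_mem[OF m_closed[OF cl cl] _ rest])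
  with \<mu>(1) cl show False using square_mem_nilradical by blast
qed

lemma coeff_ideal_coeff: "f \<in> coeff_ideal I C \<Longrightarrow> f \<mu> \<in> C \<mu>"
  by (simp add: coeff_ideal_def)

lemma coeff_ideal_carrier: "f \<in> coeff_ideal I C \<Longrightarrow> f \<in> carrier (poly_alg R I)"
  by (simp add: coeff_ideal_def)

section \<open>Powers of the radical against powers of the squarefree part\<close>

lemma coeff_ideal_pow:
  assumes N: "ideal N R"
  shows "coeff_ideal I (\<lambda>_. N) [^]\<^bsub>ideals_set (poly_alg R I)\<^esub> n
    \<subseteq> coeff_ideal I (\<lambda>_. N [^]\<^bsub>ideals_set R\<^esub> (n::nat))"
proof (induction n)
  case 0
  show ?case by (auto simp: ideal_pow_0 coeff_ideal_def coeff_closed simp del: Group.nat_pow_0)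
next
  case (Suc n)
  interpret P: cring "poly_alg R I" by (rule poly_alg_cring)
  let ?K = "\<lambda>k::nat. coeff_ideal I (\<lambda>_. N [^]\<^bsub>ideals_set R\<^esub> k)"
  interpret T: ideal "?K (Suc n)" "poly_alg R I"
    by (rule coeff_ideal_ideal) (rule ideal_pow_ideal[OF N], rule subset_refl)
  have "ideal_prod (poly_alg R I) (?K n) (coeff_ideal I (\<lambda>_. N)) \<subseteq> ?K (Suc n)"
  proof (rule T.ideal_prod_subset)
    fix g h assume g: "g \<in> ?K n" and h: "h \<in> coeff_ideal I (\<lambda>_. N)"
    have "(g \<otimes>\<^bsub>poly_alg R I\<^esub> h) \<mu> \<in> N [^]\<^bsub>ideals_set R\<^esub> Suc n" for \<mu>
    proof (rule poly_mult_coeff_mem[OF ideal_pow_ideal[OF N]])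
      fix \<alpha> \<beta>
      show "g \<alpha> \<otimes> h \<beta> \<in> N [^]\<^bsub>ideals_set R\<^esub> Suc n"
        unfolding ideal_pow_Suc
        by (rule ideal_prod.prod[OF coeff_ideal_coeff[OF g] coeff_ideal_coeff[OF h]])
    qed
    moreover have "g \<otimes>\<^bsub>poly_alg R I\<^esub> h \<in> carrier (poly_alg R I)"
      by (rule P.m_closed[OF coeff_ideal_carrier[OF g] coeff_ideal_carrier[OF h]])
    ultimately show "g \<otimes>\<^bsub>poly_alg R I\<^esub> h \<in> ?K (Suc n)"
      unfolding coeff_ideal_def by (intro CollectI conjI allI)
  qed
  with ideal_prod_mono[OF Suc subset_refl, of "poly_alg R I"] show ?case
    unfolding ideal_pow_Suc by (rule subset_trans)
qed

text \<open>The constant sum over \<open>n\<close> indices expresses the \<open>n\<close>-fold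
  multiple of \<mu>.\<close>

lemma cmonom_pow:
  assumes "c \<in> carrier R" "\<mu> \<in> exponents I"
  shows "cmonom c \<mu> [^]\<^bsub>poly_alg R I\<^esub> n = cmonom (c [^] n) (\<Sum>_<(n::nat). \<mu>) \<and> (\<Sum>_<n. \<mu>) \<in> exponents I"
proof (induction n)
  case 0
  interpret P: cring "poly_alg R I" by (rule poly_alg_cring)
  show ?case by (simp add: one_poly exponents_def)
next
  case (Suc n)
  interpret P: cring "poly_alg R I" by (rule poly_alg_cring)
  from Suc assms show ?case by (simp add: cmonom_mult exponents_add_iff)
qed

text \<open>The radical is an ideal, so only generators need checking: a high enough power of the
  squarefree monomial on the support of \<open>e\<close> is divisible by \<open>X^e\<close>.\<close>

lemma squarefree_part_subset_radical:
  assumes a: "monomial_ideal R I \<aa>"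
  shows "squarefree_part_ideal R I \<aa> \<subseteq> ideal_radical (poly_alg R I) \<aa>"
proof -
  interpret P: cring "poly_alg R I" by (rule poly_alg_cring)
  let ?E = "min_exponents R I \<aa>"
  note E = min_exponents_generate[OF a]
  have sE: "support_exponent ` ?E \<subseteq> exponents I"
    using E(1) support_exponent_exponents by blast
  have "ideal \<aa> (poly_alg R I)" by (subst E(2)) (rule monomial_coeffs_ideal)
  then have "ideal (ideal_radical (poly_alg R I) \<aa>) (poly_alg R I)" by (rule P.ideal_radical_ideal)
  moreover have "cmonom \<one> (support_exponent e) \<in> ideal_radical (poly_alg R I) \<aa>" if e: "e \<in> ?E" for e
  proof -
    \<comment> \<open>The largest entry of \<open>e\<close>; the inserted 0 provides a maximum when
      \<open>e = 0\<close>.\<close>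
    define n where "n = Max (insert 0 (Poly_Mapping.lookup e ` Poly_Mapping.keys e))"
    let ?\<nu> = "\<Sum>_<n. support_exponent e"
    have ex: "support_exponent e \<in> exponents I" using e sE by blast
    have "?\<nu> \<in> upward_closure ?E"
    proof (rule mem_upward_closure_le[OF e])
      fix i
      show "Poly_Mapping.lookup e i \<le> Poly_Mapping.lookup ?\<nu> i"
      proof (cases "i \<in> Poly_Mapping.keys e")
        case True
        then have "Poly_Mapping.lookup e i \<le> n" unfolding n_def by (intro Max_ge) auto
        with True show ?thesis by (simp add: lookup_sum lookup_support_exponent)
      qed (simp add: in_keys_iff)
    qed
    then have "cmonom \<one> (support_exponent e) [^]\<^bsub>poly_alg R I\<^esub> n \<in> \<aa>"
      using cmonom_pow[OF one_closed ex, of n] cmonom_closed[OF one_closed, of ?\<nu> I]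
      by (subst E(2)) (auto simp: coeff_ideal_def monomial_coeffs_def cmonom_def)
    then show ?thesis
      using cmonom_closed[OF one_closed ex] by (auto simp: ideal_radical_def)
  qed
  ultimately have "genideal (poly_alg R I) (cmonom \<one> ` support_exponent ` ?E)
      \<subseteq> ideal_radical (poly_alg R I) \<aa>"
    by (intro P.genideal_minimal) auto
  then show ?thesis using E(3) genideal_monomials[OF sE] by simp
qed

lemma coeff_ideal_split:
  fixes f :: "('i, 'a) mpoly"
  assumes f: "f \<in> coeff_ideal I (\<lambda>\<mu>. if \<mu> \<in> U then carrier R else N)" and N: "ideal N R"
  shows "f \<in> coeff_ideal I (monomial_coeffs U) <+>\<^bsub>poly_alg R I\<^esub> coeff_ideal I (\<lambda>_. N)"
proof -
  have fc: "f \<in> carrier (poly_alg R I)" using f by (simp add: coeff_ideal_def)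
  have sub: "(\<lambda>\<mu>. if \<mu> \<in> V then f \<mu> else \<zero>) \<in> carrier (poly_alg R I)" for V
  proof -
    have "{\<mu>. (if \<mu> \<in> V then f \<mu> else \<zero>) \<noteq> \<zero>} \<subseteq> {\<mu>. f \<mu> \<noteq> \<zero>}" by auto
    with fc show ?thesis unfolding poly_alg_carrier by (auto intro: finite_subset)
  qed
  have 1: "(\<lambda>\<mu>. if \<mu> \<in> U then f \<mu> else \<zero>) \<in> coeff_ideal I (monomial_coeffs U)"
    using sub[of U] coeff_closed[OF fc] by (simp add: coeff_ideal_def monomial_coeffs_def)
  have 2: "(\<lambda>\<mu>. if \<mu> \<in> - U then f \<mu> else \<zero>) \<in> coeff_ideal I (\<lambda>_. N)"
    using sub[of "- U"] f ideal.zero_mem[OF N] by (auto simp: coeff_ideal_def split: if_splits)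
  have 3: "f = (\<lambda>\<mu>. if \<mu> \<in> U then f \<mu> else \<zero>) \<oplus>\<^bsub>poly_alg R I\<^esub> (\<lambda>\<mu>. if \<mu> \<in> - U then f \<mu> else \<zero>)"
    using coeff_closed[OF fc] by (simp add: poly_alg_simps fun_eq_iff)
  show ?thesis by (subst 3) (rule set_add_memI[OF 1 2])
qed

text \<open>\<open>?J\<close> allows arbitrary coefficients on \<open>?U\<close> and nilpotent ones
  elsewhere. It contains \<open>\<aa>\<close> and is closed under square roots, so it contains the
  radical, and it splits into the two summands.\<close>

lemma radical_subset:
  assumes a: "monomial_ideal R I \<aa>"
  shows "ideal_radical (poly_alg R I) \<aa>
    \<subseteq> squarefree_part_ideal R I \<aa> <+>\<^bsub>poly_alg R I\<^esub> coeff_ideal I (\<lambda>_. nilradical R)"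
proof -
  interpret P: cring "poly_alg R I" by (rule poly_alg_cring)
  let ?E = "min_exponents R I \<aa>"
  let ?U = "upward_closure (support_exponent ` ?E)"
  let ?J = "coeff_ideal I (\<lambda>\<mu>. if \<mu> \<in> ?U then carrier R else nilradical R)"
  note E = min_exponents_generate[OF a] and N = nilradical_ideal
  have "ideal ?J (poly_alg R I)"
    using N upward_closure_add[of _ "support_exponent ` ?E"]
    by (intro coeff_ideal_ideal) (auto simp: oneideal ideal.Icarr)
  moreover have "f \<in> ?J"
    if "f \<in> carrier (poly_alg R I)" "f \<otimes>\<^bsub>poly_alg R I\<^esub> f \<in> ?J" for f
  proof (rule square_mem_coeff_ideal[OF _ _ that])
    show "\<mu> \<in> ?U" if "\<mu> + \<mu> \<in> ?U" for \<mu>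
      using that by (simp add: mem_upward_closure_support keys_add_nat)
  qed (rule upward_closure_add)
  moreover have "\<aa> \<subseteq> ?J"
  proof -
    have "upward_closure ?E \<subseteq> ?U"
    proof (intro upward_closure_subset subsetI)
      fix e assume "e \<in> ?E"
      then show "e \<in> ?U" unfolding mem_upward_closure_support by blast
    qed
    then have "monomial_coeffs (upward_closure ?E) \<mu> \<subseteq> (if \<mu> \<in> ?U then carrier R else nilradical R)" for \<mu>
      using ideal.zero_mem[OF N] by (auto simp: monomial_coeffs_def)
    then show ?thesis by (subst E(2)) (unfold coeff_ideal_def, blast)
  qed
  ultimately have "ideal_radical (poly_alg R I) \<aa> \<subseteq> ?J"
    by (rule P.ideal_radical_subset_if_square_closed)
  then show ?thesis using coeff_ideal_split[OF _ N, of _ I ?U] E(3) by auto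
qed

text \<open>The \<open>n\<close> surplus factors annihilate the nilpotent summand. The same
  \<open>n\<close> serves for every \<open>m\<close>, so a power of L that kills an element yields a
  power of the radical that does.\<close>

lemma radical_pow_subset:
  assumes a: "monomial_ideal R I \<aa>" and n: "nilradical R [^]\<^bsub>ideals_set R\<^esub> (n::nat) = {\<zero>}"
  shows "ideal_radical (poly_alg R I) \<aa> [^]\<^bsub>ideals_set (poly_alg R I)\<^esub> (m + n)
    \<subseteq> squarefree_part_ideal R I \<aa> [^]\<^bsub>ideals_set (poly_alg R I)\<^esub> m"
proof -
  interpret P: cring "poly_alg R I" by (rule poly_alg_cring)
  let ?L = "squarefree_part_ideal R I \<aa>" and ?K = "coeff_ideal I (\<lambda>_. nilradical R)"
  have L: "ideal ?L (poly_alg R I)"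
    unfolding min_exponents_generate(3)[OF a] by (rule monomial_coeffs_ideal)
  have K: "ideal ?K (poly_alg R I)" by (rule coeff_ideal_ideal) (simp_all add: nilradical_ideal)
  have "?K [^]\<^bsub>ideals_set (poly_alg R I)\<^esub> n \<subseteq> {\<zero>\<^bsub>poly_alg R I\<^esub>}"
    using coeff_ideal_pow[OF nilradical_ideal, of I n] n
    by (auto simp: coeff_ideal_def poly_alg_simps)
  then have "?L [^]\<^bsub>ideals_set (poly_alg R I)\<^esub> m <+>\<^bsub>poly_alg R I\<^esub> ?K [^]\<^bsub>ideals_set (poly_alg R I)\<^esub> n
      \<subseteq> ?L [^]\<^bsub>ideals_set (poly_alg R I)\<^esub> m <+>\<^bsub>poly_alg R I\<^esub> {\<zero>\<^bsub>poly_alg R I\<^esub>}"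
    by (intro P.set_add_mono) auto
  also have "\<dots> \<subseteq> ?L [^]\<^bsub>ideals_set (poly_alg R I)\<^esub> m"
    using ideal.Icarr[OF P.ideal_pow_ideal[OF L]] by (auto simp: set_add_def')
  finally show ?thesis
    using ideal_pow_mono[OF radical_subset[OF a], where n = "m + n"] P.ideal_sum_pow[OF L K, of m n]
    by blast
qed

section \<open>Torsion functors\<close>

text \<open>Annihilators reverse inclusions, so the two comparisons of ideal powers become the two
  inclusions of torsion parts.\<close>

lemma nilpotent_imp_torsion_functors_eq:
  fixes I :: "'i set"
  assumes "nilpotent_ideal R (nilradical R)" and a: "monomial_ideal R I \<aa>"
  shows "monomial_torsion_eq TYPE('u) R I G \<psi> \<aa>"
proof -
  obtain n :: nat where n: "nilradical R [^]\<^bsub>ideals_set R\<^esub> n = {\<zero>}"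
    using assms(1) by (auto simp: nilpotent_ideal_def)
  let ?P = "poly_alg R I"
  let ?L = "squarefree_part_ideal R I \<aa>" and ?Q = "ideal_radical (poly_alg R I) \<aa>"
  have anti: "annihilated_part M S \<subseteq> annihilated_part M T" if "T \<subseteq> S"
    for M :: "(('i, 'a) mpoly, ('i, 'a) mpoly + 'u) module" and S T
    using that unfolding annihilated_part_def by blast
  have "torsion ?P ?L M \<subseteq> torsion ?P ?Q M" for M :: "(('i, 'a) mpoly, ('i, 'a) mpoly + 'u) module"
  proof
    fix x assume "x \<in> torsion ?P ?L M"
    then obtain m :: nat where "x \<in> annihilated_part M (?L [^]\<^bsub>ideals_set ?P\<^esub> m)"
      by (auto simp: torsion_def)
    then have "x \<in> annihilated_part M (?Q [^]\<^bsub>ideals_set ?P\<^esub> (m + n))"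
      by (rule subsetD[OF anti[OF radical_pow_subset[OF a n]]])
    then show "x \<in> torsion ?P ?Q M" unfolding torsion_def by blast
  qed
  moreover have "torsion ?P ?Q M \<subseteq> torsion ?P ?L M" for M :: "(('i, 'a) mpoly, ('i, 'a) mpoly + 'u) module"
    unfolding torsion_def
    by (intro UN_mono subset_refl anti ideal_pow_mono squarefree_part_subset_radical[OF a])
  ultimately show ?thesis
    unfolding monomial_torsion_eq_def torsion_functors_eq_def by (intro allI impI equalityI)
qed

section \<open>The test module\<close>

text \<open>The exponent 0 decomposes only as \<open>0 + 0\<close>. Multiplicativity of the constant
  term lets polynomials act on the coefficient ring through it.\<close>

lemma coeff_zero_mult:
  assumes f: "f \<in> carrier (poly_alg R I)" and g: "g \<in> carrier (poly_alg R I)"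
  shows "(f \<otimes>\<^bsub>poly_alg R I\<^esub> g) 0 = f 0 \<otimes> g 0"
proof -
  have "{(\<alpha>, \<beta>). \<alpha> + \<beta> = (0 :: 'c \<Rightarrow>\<^sub>0 nat)} = {(0, 0)}"
    using add_eq_0_poly_mapping_nat by fastforce
  then show ?thesis
    using coeff_closed[OF f] coeff_closed[OF g] by (simp add: poly_alg_simps)
qed

text \<open>The ring as a module over its polynomial algebra, with all variables acting as zero. Only the
  element type forces the encoding of elements as constant functions on the exponents. The
  multiplicative structure of the record plays no role for modules.\<close>

definition const_elem :: "'a \<Rightarrow> ('i, 'a) mpoly + 'u" where
  "const_elem a = Inl (\<lambda>_. a)"

definition const_value :: "('i, 'a) mpoly + 'u \<Rightarrow> 'a" where
  "const_value x = projl x 0"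

definition const_module :: "(('i, 'a) mpoly, ('i, 'a) mpoly + 'u) module" where
  "const_module =
    \<lparr> carrier = const_elem ` carrier R,
      monoid.mult = (\<lambda>x y. const_elem (const_value x \<otimes> const_value y)),
      monoid.one = const_elem \<one>,
      ring.zero = const_elem \<zero>,
      ring.add = (\<lambda>x y. const_elem (const_value x \<oplus> const_value y)),
      module.smult = (\<lambda>f x. const_elem (f 0 \<otimes> const_value x)) \<rparr>"

lemma const_value_const_elem: "const_value (const_elem a) = a"
  by (simp add: const_value_def const_elem_def)

lemma const_elem_eq_iff: "const_elem a = const_elem b \<longleftrightarrow> a = b"
  by (auto simp: const_elem_def fun_eq_iff)

lemma const_module_simps:
  "carrier const_module = const_elem ` carrier R"
  "\<zero>\<^bsub>const_module\<^esub> = const_elem \<zero>"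
  "const_elem a \<oplus>\<^bsub>const_module\<^esub> const_elem b = const_elem (a \<oplus> b)"
  "f \<odot>\<^bsub>const_module\<^esub> const_elem a = const_elem (f 0 \<otimes> a)"
  by (simp_all add: const_module_def const_value_const_elem)

lemma const_module_module: "module (poly_alg R I) const_module"
proof (rule moduleI)
  show "abelian_group const_module"
  proof (rule abelian_groupI)
    fix x assume "x \<in> carrier const_module"
    then obtain a where a: "a \<in> carrier R" "x = const_elem a" by (auto simp: const_module_simps)
    then have "const_elem (\<ominus> a) \<in> carrier const_module"
      "const_elem (\<ominus> a) \<oplus>\<^bsub>const_module\<^esub> x = \<zero>\<^bsub>const_module\<^esub>"
      by (simp_all add: const_module_simps l_neg)
    then show "\<exists>y\<in>carrier const_module. y \<oplus>\<^bsub>const_module\<^esub> x = \<zero>\<^bsub>const_module\<^esub>" by blast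
  qed (auto simp: const_module_simps a_ac)
qed (auto simp: poly_alg_cring const_module_simps const_elem_eq_iff coeff_closed coeff_zero_mult
    l_distr r_distr m_assoc poly_alg_simps(2,3))

definition const_component :: "('g, 'l) monoid_scheme \<Rightarrow> 'g \<Rightarrow> (('i, 'a) mpoly + 'u) set" where
  "const_component G g = (if g = \<one>\<^bsub>G\<^esub> then const_elem ` carrier R else {const_elem \<zero>})"

text \<open>The exponent 0 has as degree the unit of \<open>G\<close>, so homogeneous polynomials of
  any other degree have zero constant term; acting through the constant term therefore respects
  degrees.\<close>

lemma const_module_graded:
  fixes I :: "'i set"
  assumes "comm_group G" and \<psi>: "\<psi> \<in> hom (free_Abelian_group I) G"
  shows "graded_module (poly_alg R I) (poly_component R I \<psi>) G
    (const_module :: (('i, 'a) mpoly, ('i, 'a) mpoly + 'u) module) (const_component G)"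
proof -
  let ?M = "const_module :: (('i, 'a) mpoly, ('i, 'a) mpoly + 'u) module"
  interpret G: comm_group G by fact
  interpret M: module "poly_alg R I" ?M
    by (rule const_module_module)
  have \<psi>0: "\<psi> 0 = \<one>\<^bsub>G\<^esub>"
    using hom_one[OF \<psi>] by (simp add: G.is_group)
  have map0: "Poly_Mapping.map int 0 = 0"
    by (rule poly_mapping_eqI) (simp add: Poly_Mapping.map.rep_eq)
  show ?thesis
  proof (intro graded_module.intro graded_module_axioms.intro M.module_axioms)
    fix g assume "g \<in> carrier G"
    show "additive_subgroup (const_component G g) ?M"
    proof (rule additive_subgroup.intro, rule M.add.subgroupI)
      show "\<ominus>\<^bsub>?M\<^esub> x \<in> const_component G g" if x: "x \<in> const_component G g" for x
      proof (cases "g = \<one>\<^bsub>G\<^esub>")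
        case True
        then show ?thesis
          using x M.a_inv_closed[of x] by (simp add: const_component_def const_module_simps)
      next
        case False
        then show ?thesis
          using x M.minus_equality[of "const_elem \<zero>" "const_elem \<zero>"]
          by (simp add: const_component_def const_module_simps)
      qed
    qed (auto simp: const_component_def const_module_simps)
  next
    fix g h and r :: "('i, 'a) mpoly" and x :: "('i, 'a) mpoly + 'u"
    assume g: "g \<in> carrier G" and h: "h \<in> carrier G"
      and r: "r \<in> poly_component R I \<psi> g" and x: "x \<in> const_component G h"
    have rc: "r 0 \<in> carrier R" using r coeff_closed[of r I 0] by (simp add: poly_component_def)
    show "r \<odot>\<^bsub>?M\<^esub> x \<in> const_component G (g \<otimes>\<^bsub>G\<^esub> h)"
    proof (cases "h = \<one>\<^bsub>G\<^esub>")
      case True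
      then obtain a where a: "x = const_elem a" "a \<in> carrier R"
        using x by (auto simp: const_component_def)
      have "r 0 = \<zero>" if "g \<noteq> \<one>\<^bsub>G\<^esub>"
        using r that by (auto simp: poly_component_def \<psi>0 map0)
      with a g rc True show ?thesis
        by (auto simp: const_component_def const_module_simps)
    next
      case False
      then have "x = const_elem \<zero>" using x by (simp add: const_component_def)
      then show ?thesis
        using rc by (auto simp: const_component_def const_module_simps)
    qed
  next
    fix x :: "('i, 'a) mpoly + 'u" assume "x \<in> carrier ?M"
    let ?S = "\<lambda>y :: _ \<Rightarrow> ('i, 'a) mpoly + 'u. {g \<in> carrier G. y g \<noteq> \<zero>\<^bsub>?M\<^esub>}"
    \<comment> \<open>Only the component at the unit can be nonzero, so each sum collapses to its
      value there; existence and uniqueness of the decomposition both follow.\<close>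
    have comp: "finite (?S y) \<and> finsum ?M y (?S y) = y \<one>\<^bsub>G\<^esub>"
      if y: "y \<in> (\<Pi>\<^sub>E g\<in>carrier G. const_component G g)" for y
    proof -
      have "y g = \<zero>\<^bsub>?M\<^esub>" if "g \<in> carrier G" "g \<noteq> \<one>\<^bsub>G\<^esub>" for g
        using PiE_mem[OF y that(1)] that(2) by (simp add: const_component_def const_module_simps)
      then have sub: "?S y \<subseteq> {\<one>\<^bsub>G\<^esub>}" by blast
      have "y \<one>\<^bsub>G\<^esub> \<in> carrier ?M"
        using PiE_mem[OF y G.one_closed] by (simp add: const_component_def const_module_simps)
      moreover have "?S y = (if y \<one>\<^bsub>G\<^esub> = \<zero>\<^bsub>?M\<^esub> then {} else {\<one>\<^bsub>G\<^esub>})"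
        using sub by auto
      ultimately show ?thesis by simp
    qed
    \<comment> \<open>The value \<open>undefined\<close> outside the carrier is what extensionality
      of \<open>\<Pi>\<^sub>E\<close> requires.\<close>
    let ?y = "\<lambda>g. if g \<in> carrier G then if g = \<one>\<^bsub>G\<^esub> then x else \<zero>\<^bsub>?M\<^esub> else undefined"
    have y: "?y \<in> (\<Pi>\<^sub>E g\<in>carrier G. const_component G g)"
      using \<open>x \<in> carrier ?M\<close>
      by (auto simp: const_component_def const_module_simps)
    show "\<exists>!y. y \<in> (\<Pi>\<^sub>E g\<in>carrier G. const_component G g) \<and> finite (?S y) \<and>
        x = finsum ?M y (?S y)"
    proof (rule ex1I[of _ ?y])
      show "?y \<in> (\<Pi>\<^sub>E g\<in>carrier G. const_component G g) \<and> finite (?S ?y) \<and>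
          x = finsum ?M ?y (?S ?y)"
        using y comp[OF y] by simp
      fix z assume z: "z \<in> (\<Pi>\<^sub>E g\<in>carrier G. const_component G g) \<and> finite (?S z) \<and>
          x = finsum ?M z (?S z)"
      then have zx: "z \<one>\<^bsub>G\<^esub> = x" using comp by simp
      show "z = ?y"
      proof (rule PiE_ext[OF conjunct1[OF z] y])
        fix g assume g: "g \<in> carrier G"
        show "z g = ?y g"
          using PiE_mem[OF conjunct1[OF z] g] g zx
          by (auto simp: const_component_def const_module_simps)
      qed
    qed
  qed
qed

section \<open>Recovering nilpotency from torsion\<close>

text \<open>A nilpotent constant has a power equal to zero and so lies in the radical of every
  ideal. Passing to constant polynomials preserves sums and products, which transports membership to
  ideal powers.\<close>

lemma const_mem_radical_pow:
  assumes a: "ideal \<aa> (poly_alg R I)" and c: "c \<in> nilradical R [^]\<^bsub>ideals_set R\<^esub> (n::nat)"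
  shows "cmonom c 0 \<in> ideal_radical (poly_alg R I) \<aa> [^]\<^bsub>ideals_set (poly_alg R I)\<^esub> n"
  using c
proof (induction n arbitrary: c)
  case 0
  then show ?case
    by (simp add: ideal_pow_0 exponents_def cmonom_closed del: Group.nat_pow_0)
next
  case (Suc n)
  have e0: "0 \<in> exponents I" by (simp add: exponents_def)
  note N = ideal_pow_ideal[OF nilradical_ideal, of n]
  have "c \<in> ideal_prod R (nilradical R [^]\<^bsub>ideals_set R\<^esub> n) (nilradical R)"
    using Suc.prems by (simp only: ideal_pow_Suc)
  then have "cmonom c 0 \<in> ideal_prod (poly_alg R I)
      (ideal_radical (poly_alg R I) \<aa> [^]\<^bsub>ideals_set (poly_alg R I)\<^esub> n) (ideal_radical (poly_alg R I) \<aa>)"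
  proof (induction c rule: ideal_prod.induct)
    case (prod b d)
    have bd: "b \<in> carrier R" "d \<in> carrier R"
      using ideal.Icarr[OF N prod(1)] ideal.Icarr[OF nilradical_ideal prod(2)] .
    obtain k :: nat where k: "d [^] k = \<zero>" using prod(2) by (auto simp: nilradical_def ideal_radical_def)
    have "cmonom d 0 [^]\<^bsub>poly_alg R I\<^esub> k = \<zero>\<^bsub>poly_alg R I\<^esub>"
      using cmonom_pow[OF bd(2) e0, of k] k by (simp add: cmonom_def poly_alg_simps)
    then have "cmonom d 0 [^]\<^bsub>poly_alg R I\<^esub> k \<in> \<aa>" using ideal.zero_mem[OF a] by simp
    then have "cmonom d 0 \<in> ideal_radical (poly_alg R I) \<aa>"
      using cmonom_closed[OF bd(2) e0] unfolding ideal_radical_def by blast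
    then have "cmonom b 0 \<otimes>\<^bsub>poly_alg R I\<^esub> cmonom d 0 \<in> ideal_prod (poly_alg R I)
        (ideal_radical (poly_alg R I) \<aa> [^]\<^bsub>ideals_set (poly_alg R I)\<^esub> n) (ideal_radical (poly_alg R I) \<aa>)"
      by (rule ideal_prod.prod[OF Suc.IH[OF prod(1)]])
    then show ?case by (simp add: cmonom_mult[OF bd e0])
  next
    case (sum b d)
    have "cmonom b 0 \<oplus>\<^bsub>poly_alg R I\<^esub> cmonom d 0 \<in> ideal_prod (poly_alg R I)
        (ideal_radical (poly_alg R I) \<aa> [^]\<^bsub>ideals_set (poly_alg R I)\<^esub> n) (ideal_radical (poly_alg R I) \<aa>)"
      by (rule ideal_prod.sum[OF sum.IH])
    moreover have "cmonom b 0 \<oplus>\<^bsub>poly_alg R I\<^esub> cmonom d 0 = cmonom (b \<oplus> d) 0"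
      by (auto simp: poly_alg_simps cmonom_def)
    ultimately show ?case by simp
  qed
  then show ?case by (simp only: ideal_pow_Suc)
qed

lemma torsion_functors_eq_imp_nilpotent:
  fixes I :: "'i set"
  assumes G: "comm_group G" and \<psi>: "\<psi> \<in> hom (free_Abelian_group I) G"
    and a: "monomial_ideal R I \<aa>" and proper: "\<aa> \<noteq> carrier (poly_alg R I)"
    and eq: "monomial_torsion_eq TYPE('u) R I G \<psi> \<aa>"
  shows "nilpotent_ideal R (nilradical R)"
proof -
  interpret P: cring "poly_alg R I" by (rule poly_alg_cring)
  let ?P = "poly_alg R I"
  let ?M = "const_module :: (('i, 'a) mpoly, ('i, 'a) mpoly + 'u) module"
  let ?L = "squarefree_part_ideal R I \<aa>" and ?Q = "ideal_radical (poly_alg R I) \<aa>"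
  let ?E = "min_exponents R I \<aa>"
  note E = min_exponents_generate[OF a]
  have aI: "ideal \<aa> ?P" by (subst E(2)) (rule monomial_coeffs_ideal)
  have L: "ideal ?L ?P" unfolding E(3) by (rule monomial_coeffs_ideal)
  \<comment> \<open>Properness enters here. With 0 excluded, every generator of L involves a
    variable, so no element of L has a constant term.\<close>
  have "0 \<notin> ?E"
  proof
    assume "0 \<in> ?E"
    then have "\<mu> \<in> upward_closure ?E" for \<mu> by (rule mem_upward_closure_le) simp
    then have "coeff_ideal I (monomial_coeffs (upward_closure ?E)) = carrier ?P"
      by (auto simp: coeff_ideal_def monomial_coeffs_def coeff_closed)
    with E(2) proper show False by simp
  qed
  then have "0 \<notin> upward_closure (support_exponent ` ?E)"
    by (auto simp: mem_upward_closure_support)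
  then have L0: "f 0 = \<zero>" if "f \<in> ?L" for f :: "('i, 'a) mpoly"
    using coeff_ideal_coeff[of f I _ 0] that unfolding E(3) monomial_coeffs_def by fastforce
  \<comment> \<open>The exponent is 1 because the zeroth power is the whole ring; the first power
    unfolds to the product of the ring with L.\<close>
  have "?L [^]\<^bsub>ideals_set ?P\<^esub> Suc 0 \<subseteq> ?L"
    unfolding ideal_pow_Suc ideal_pow_0 using P.ideal_prod_inter[OF P.oneideal L] by blast
  then have "f \<odot>\<^bsub>?M\<^esub> const_elem \<one> = \<zero>\<^bsub>?M\<^esub>" if "f \<in> ?L [^]\<^bsub>ideals_set ?P\<^esub> Suc 0" for f :: "('i, 'a) mpoly"
    using that L0[of f] by (auto simp: const_module_simps)
  then have "const_elem \<one> \<in> annihilated_part ?M (?L [^]\<^bsub>ideals_set ?P\<^esub> Suc 0)"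
    unfolding annihilated_part_def const_module_simps(1) by blast
  then have "const_elem \<one> \<in> torsion ?P ?L ?M" unfolding torsion_def by blast
  moreover have "torsion ?P ?L ?M = torsion ?P ?Q ?M"
    using eq const_module_graded[OF G \<psi>]
    unfolding monomial_torsion_eq_def torsion_functors_eq_def by blast
  ultimately have "const_elem \<one> \<in> torsion ?P ?Q ?M" by simp
  then obtain n :: nat where "const_elem \<one> \<in> annihilated_part ?M (?Q [^]\<^bsub>ideals_set ?P\<^esub> n)"
    unfolding torsion_def by blast
  then have n: "f \<odot>\<^bsub>?M\<^esub> const_elem \<one> = \<zero>\<^bsub>?M\<^esub>" if "f \<in> ?Q [^]\<^bsub>ideals_set ?P\<^esub> n" for f :: "('i, 'a) mpoly"
    using that unfolding annihilated_part_def by blast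
  note Nn = ideal_pow_ideal[OF nilradical_ideal, of n]
  \<comment> \<open>The constant polynomial \<open>c\<close> sends the element 1 to
    \<open>c\<close>, so annihilating 1 means being zero.\<close>
  have "c = \<zero>" if c: "c \<in> nilradical R [^]\<^bsub>ideals_set R\<^esub> n" for c
    using n[OF const_mem_radical_pow[OF aI c]] ideal.Icarr[OF Nn c]
    by (simp add: const_module_simps const_elem_eq_iff cmonom_def)
  then have "nilradical R [^]\<^bsub>ideals_set R\<^esub> n = {\<zero>}"
    using ideal.zero_mem[OF Nn] by blast
  then show ?thesis unfolding nilpotent_ideal_def by blast
qed

text \<open>The empty set of monomials generates it. It is the witness for the existence
  statement.\<close>

lemma zero_monomial_ideal: "monomial_ideal R I {\<zero>\<^bsub>poly_alg R I\<^esub>}"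
proof -
  interpret P: cring "poly_alg R I" by (rule poly_alg_cring)
  have "genideal (poly_alg R I) {} = {\<zero>\<^bsub>poly_alg R I\<^esub>}"
  proof
    show "genideal (poly_alg R I) {} \<subseteq> {\<zero>\<^bsub>poly_alg R I\<^esub>}"
      by (rule P.genideal_minimal[OF P.zeroideal]) simp
    show "{\<zero>\<^bsub>poly_alg R I\<^esub>} \<subseteq> genideal (poly_alg R I) {}"
      using ideal.zero_mem[OF P.genideal_ideal[of "{}"]] by simp
  qed
  then show ?thesis unfolding monomial_ideal_def by (intro exI[of _ "{}"]) simp
qed

text \<open>If the zero ideal is everything, the constant 1 vanishes. So this witness is proper
  except over the zero ring, the case that the existence statement admits separately.\<close>

lemma zero_poly_ideal_proper:
  assumes "{\<zero>\<^bsub>poly_alg R I\<^esub>} = carrier (poly_alg R I)"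
  shows "carrier R = {\<zero>}"
proof -
  have "cmonom \<one> 0 \<in> carrier (poly_alg R I)"
    by (rule cmonom_closed) (simp_all add: exponents_def)
  then have "cmonom \<one> 0 = \<zero>\<^bsub>poly_alg R I\<^esub>" unfolding assms[symmetric] by blast
  from fun_cong[OF this, of 0] show ?thesis by (simp add: carrier_one_zero cmonom_def poly_alg_simps)
qed

text \<open>The exponent 0 works, since the zeroth power of an ideal is the ring itself.\<close>

lemma zero_ring_nilradical_nilpotent:
  "carrier R = {\<zero>} \<Longrightarrow> nilpotent_ideal R (nilradical R)"
  unfolding nilpotent_ideal_def by (rule exI[of _ 0]) (simp only: ideal_pow_0)

end

theorem mainTheorem2:
  fixes A :: "('a, 'k) ring_scheme"
    and I :: "'i set"
    and G :: "('g, 'l) monoid_scheme"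
    and \<psi> :: "('i \<Rightarrow>\<^sub>0 int) \<Rightarrow> 'g"
  assumes "cring A"
    and "comm_group G"
    and "\<psi> \<in> epi (free_Abelian_group I) G"
  shows "(nilpotent_ideal A (nilradical A) \<longleftrightarrow>
            (\<forall>\<aa>. monomial_ideal A I \<aa> \<longrightarrow> monomial_torsion_eq TYPE('u) A I G \<psi> \<aa>)) \<and>
         (nilpotent_ideal A (nilradical A) \<longleftrightarrow>
            (\<exists>\<aa>. monomial_ideal A I \<aa> \<and>
                 (\<aa> \<noteq> carrier (poly_alg A I) \<or> carrier A = {\<zero>\<^bsub>A\<^esub>}) \<and>
                 monomial_torsion_eq TYPE('u) A I G \<psi> \<aa>))"
    (is "(?i \<longleftrightarrow> ?ii) \<and> (?i \<longleftrightarrow> ?iii)")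
proof -
  interpret cring A by fact
  have "?i \<Longrightarrow> ?ii"
    by (intro allI impI nilpotent_imp_torsion_functors_eq)
  moreover have "?ii \<Longrightarrow> ?iii"
    using zero_monomial_ideal[of I] zero_poly_ideal_proper[of I] by blast
  moreover have "?iii \<Longrightarrow> ?i"
  proof -
    assume ?iii
    then obtain \<aa> where a: "monomial_ideal A I \<aa>" "monomial_torsion_eq TYPE('u) A I G \<psi> \<aa>"
      "\<aa> \<noteq> carrier (poly_alg A I) \<or> carrier A = {\<zero>\<^bsub>A\<^esub>}" by blast
    have "\<psi> \<in> hom (free_Abelian_group I) G" using assms(3) by (simp add: epi_def)
    with a assms(2) show ?i
      using torsion_functors_eq_imp_nilpotent zero_ring_nilradical_nilpotent by blast
  qed
  ultimately show ?thesis by blast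
qed

end
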